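(* Let $K\ge 2$, $\epsilon\in(0,\tfrac12)$, and let $S:\mathcal X\times[K]\to\mathbb{R}$ be a score function. Let $(X,Y)$ be a clean pair with $Y\in[K]$, and let the observed label $\tilde Y$ equal $Y$ with probability $1-\epsilon$ and a draw $Y^c$ from a corrupting distribution on $[K]$ with probability $\epsilon$, with $\tilde Y$ conditionally independent of $X$ given $Y$. Let $P_i=\mathbb{P}(Y=i)$, $\tilde P_i=\mathbb{P}(\tilde Y=i)>0$, and let $P\in\mathbb{R}^{K\times K}$ with $P_{ji}=\mathbb{P}(Y=j\mid\tilde Y=i)$ be invertible, with inverse entries $P^{-1}_{ji}$. Define $F_1(q)=\mathbb{P}(S(X,Y)\le q)$, $\tilde F(q)=\mathbb{P}(S(X,\tilde Y)\le q)$, $g(q)=F_1(q)-\tilde F(q)$, and $\tilde F(q;i,j)=\mathbb{P}(S(X,i)\le q\mid\tilde Y=j)$. Given i.i.d. calibration data $(X_\ell,\tilde Y_\ell)$, $\ell=1,\dots,n$, distributed as $(X,\tilde Y)$, let $$\tilde F_n(q;i,j)=\frac{\sum_{\ell=1}^n\mathbf 1(S(X_\ell,i)\le q)\mathbf 1(\tilde Y_\ell=j)}{\sum_{\ell=1}^n\mathbf 1(\tilde Y_\ell=j)}\quad(0/0:=0),$$ $$\hat g(q)=\sum_{i=1}^K\sum_{j=1}^K P_iP^{-1}_{ji}\tilde F_n(q;i,j)-\sum_{i=1}^K\tilde P_i\tilde F_n(q;i,i).$$ Set $w^{(1)}_i=P^{-1}_{ii}P_i-\tilde P_i$, $w^{(2)}_{ij}=P_iP^{-1}_{ji}$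 and $b(n,j)=(1-\tilde P_j)^n+\sqrt{\frac{\pi}{n\tilde P_j}}$. Then for any $k\in[n]$, with $S_{(k)}$ the $k$-th order statistic of the calibration scores $S(X_\ell,\tilde Y_\ell)$, $$\mathbb{E}\big[|\hat g(S_{(k)})-g(S_{(k)})|\big]\le B(n,\epsilon):=\sum_{i=1}^K\Big(|w^{(1)}_i|\,b(n,i)+\sum_{j\ne i}|w^{(2)}_{ij}|\,b(n,j)\Big).$$
   Context: $[K]=\{1,\dots,K\}$. All probabilities are with respect to the joint distribution described; the calibration pairs are independent. *)

theory Defs
  imports "HOL-Probability.Probability"
begin

text \<open>Labels are natural numbers in {1..K}. M is the underlying probability space.\<close>

definition lab_prob :: "'a measure \<Rightarrow> ('a \<Rightarrow> nat) \<Rightarrow> nat \<Rightarrow> real" where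
  "lab_prob M Y i = measure M {\<omega> \<in> space M. Y \<omega> = i}"

definition trans_mat :: "'a measure \<Rightarrow> ('a \<Rightarrow> nat) \<Rightarrow> ('a \<Rightarrow> nat) \<Rightarrow> nat \<Rightarrow> nat \<Rightarrow> real" where
  "trans_mat M Y Yt j i =
     measure M {\<omega> \<in> space M. Y \<omega> = j \<and> Yt \<omega> = i} / lab_prob M Yt i"

definition is_inverse_mat :: "nat \<Rightarrow> (nat \<Rightarrow> nat \<Rightarrow> real) \<Rightarrow> (nat \<Rightarrow> nat \<Rightarrow> real) \<Rightarrow> bool" where
  "is_inverse_mat K A B \<longleftrightarrow>
     (\<forall>i\<in>{1..K}. \<forall>l\<in>{1..K}. (\<Sum>m=1..K. A i m * B m l) = (if i = l then 1 else 0)) \<and>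
     (\<forall>i\<in>{1..K}. \<forall>l\<in>{1..K}. (\<Sum>m=1..K. B i m * A m l) = (if i = l then 1 else 0))"

definition cond_indep_given_label ::
  "'a measure \<Rightarrow> 'x measure \<Rightarrow> ('a \<Rightarrow> 'x) \<Rightarrow> ('a \<Rightarrow> nat) \<Rightarrow> ('a \<Rightarrow> nat) \<Rightarrow> bool" where
  "cond_indep_given_label M MX X Y Yt \<longleftrightarrow>
     (\<forall>A\<in>sets MX. \<forall>i j.
        measure M {\<omega> \<in> space M. X \<omega> \<in> A \<and> Yt \<omega> = j \<and> Y \<omega> = i} * measure M {\<omega> \<in> space M. Y \<omega> = i}
        = measure M {\<omega> \<in> space M. X \<omega> \<in> A \<and> Y \<omega> = i} * measure M {\<omega> \<in> space M. Yt \<omega> = j \<and> Y \<omega> = i})"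

text \<open>Empirical conditional CDF  F_n(q;i,j) with 0/0 = 0 (division by zero is 0 in HOL).\<close>
definition emp_cond_cdf ::
  "('x \<Rightarrow> nat \<Rightarrow> real) \<Rightarrow> nat \<Rightarrow> (nat \<Rightarrow> 'x) \<Rightarrow> (nat \<Rightarrow> nat) \<Rightarrow> real \<Rightarrow> nat \<Rightarrow> nat \<Rightarrow> real" where
  "emp_cond_cdf S n xs ys q i j =
     (\<Sum>l=1..n. (if S (xs l) i \<le> q then 1 else 0) * (if ys l = j then 1 else 0))
     / (\<Sum>l=1..n. (if ys l = j then 1 else 0))"

definition order_stat ::
  "('x \<Rightarrow> nat \<Rightarrow> real) \<Rightarrow> nat \<Rightarrow> (nat \<Rightarrow> 'x) \<Rightarrow> (nat \<Rightarrow> nat) \<Rightarrow> nat \<Rightarrow> real" where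
  "order_stat S n xs ys k = sort (map (\<lambda>l. S (xs l) (ys l)) [1..<n+1]) ! (k - 1)"

definition b_fun :: "nat \<Rightarrow> real \<Rightarrow> real" where
  "b_fun n p = (1 - p) ^ n + sqrt (pi / (real n * p))"

text \<open>The coin B is independent of the triple (X, Y, Yc) (checked on measurable rectangles,
  which generate the product sigma-algebra).\<close>
definition flip_indep ::
  "'a measure \<Rightarrow> 'x measure \<Rightarrow> ('a \<Rightarrow> bool) \<Rightarrow> ('a \<Rightarrow> 'x) \<Rightarrow> ('a \<Rightarrow> nat) \<Rightarrow> ('a \<Rightarrow> nat) \<Rightarrow> bool" where
  "flip_indep M MX B X Y Yc \<longleftrightarrow>
     (\<forall>A\<in>sets MX. \<forall>b i c.
        measure M {\<omega> \<in> space M. B \<omega> = b \<and> X \<omega> \<in> A \<and> Y \<omega> = i \<and> Yc \<omega> = c}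
        = measure M {\<omega> \<in> space M. B \<omega> = b} * measure M {\<omega> \<in> space M. X \<omega> \<in> A \<and> Y \<omega> = i \<and> Yc \<omega> = c})"

end

theory Submission
  imports Defs
begin

text \<open>
  Conditional independence of the features and the noisy label expresses \<open>g\<close> through the
  conditional distribution functions given the noisy label with the same weights as the estimator.
  So it suffices to bound the expected uniform deviation of each empirical conditional distribution
  function by \<open>b(n,j)\<close>; the threshold may then be any random quantity, such as an order statistic.

  Condition on the set \<open>J\<close> of calibration points carrying label \<open>j\<close>. If \<open>J\<close> is empty the
  deviation is at most 1, which contributes \<open>(1 - p)^n\<close>. If \<open>J\<close> has \<open>m > 0\<close> elements, the scores in
  \<open>J\<close> are i.i.d.; a ghost sample of the same size reduces the deviation to that of a uniformly random
  split of \<open>2m\<close> points into halves, and the reflection principle bounds the number of splits whose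
  first half ever leads by \<open>r\<close> by \<open>2m choose (m + r)\<close>. Summing \<open>2r - 1\<close> against these tails bounds
  the second moment of the uniform deviation by \<open>2 / (m + 1)\<close>, and
  \<open>E[2 / (N + 1)] \<le> 2 / ((n + 1) p)\<close> for binomial \<open>N\<close>. Since \<open>2 \<le> pi\<close>, no sharp form of the
  Dvoretzky-Kiefer-Wolfowitz inequality is needed.
\<close>

section \<open>Random splits and the reflection principle\<close>

text \<open>This is a lattice path in disguise: in increasing order of \<open>z\<close>, points of
  \<open>A\<close> are up-steps and points of \<open>L - A\<close> down-steps, and the path has to
  reach height \<open>r\<close>. Thresholds instead of ranks let tied values enter together, so
  atoms of the score distribution need no separate treatment.\<close>

definition leads_by :: "'i set \<Rightarrow> ('i \<Rightarrow> real) \<Rightarrow> nat \<Rightarrow> 'i set \<Rightarrow> bool" where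
  "leads_by L z r A \<longleftrightarrow>
     (\<exists>q. card {l \<in> L - A. z l \<le> q} + r \<le> card {l \<in> A. z l \<le> q})"

text \<open>Counts change only at sample values, so the largest value not exceeding \<open>q\<close>
  does the work of \<open>q\<close>; \<open>0 < r\<close> ensures that such a value exists. The
  finite quantifier serves both the induction below and measurability.\<close>

lemma leads_by_iff_sample_point:
  assumes "finite L" "A \<subseteq> L" "0 < r"
  shows "leads_by L z r A \<longleftrightarrow>
    (\<exists>t\<in>L. card {l \<in> L - A. z l \<le> z t} + r \<le> card {l \<in> A. z l \<le> z t})"
proof
  assume "leads_by L z r A"
  then obtain q where le: "card {l \<in> L - A. z l \<le> q} + r \<le> card {l \<in> A. z l \<le> q}"
    unfolding leads_by_def by blast
  let ?Q = "{l \<in> L. z l \<le> q}"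
  have "{l \<in> A. z l \<le> q} \<noteq> {}"
  proof
    assume "{l \<in> A. z l \<le> q} = {}"
    then show False using le \<open>0 < r\<close> by (simp only: card.empty)
  qed
  then have ne: "?Q \<noteq> {}" using \<open>A \<subseteq> L\<close> by blast
  have fin: "finite ?Q" using \<open>finite L\<close> by simp
  have "Max (z ` ?Q) \<in> z ` ?Q" using fin ne by (intro Max_in) auto
  then obtain t where t: "t \<in> ?Q" "z t = Max (z ` ?Q)" by auto
  have "z l \<le> q \<longleftrightarrow> z l \<le> z t" if "l \<in> L" for l
    using t fin that by auto
  then have "{l \<in> L - A. z l \<le> z t} = {l \<in> L - A. z l \<le> q}"
    "{l \<in> A. z l \<le> z t} = {l \<in> A. z l \<le> q}" using \<open>A \<subseteq> L\<close> by auto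
  then show "\<exists>t\<in>L. card {l \<in> L - A. z l \<le> z t} + r \<le> card {l \<in> A. z l \<le> z t}"
    using le t by (intro bexI[of _ t]) auto
qed (auto simp: leads_by_def)

text \<open>Reflection principle: a path with \<open>a\<close> up-steps and \<open>b\<close>
  down-steps, reflected after it first reaches height \<open>r\<close>, has \<open>b + r\<close>
  up-steps. Instead of constructing the reflection, the induction removes the first step and
  combines the two cases by Pascal's rule. With ties the path is seen only at the ends of blocks of
  equal values, which can only lower the count.\<close>

lemma card_leads_by_le:
  assumes "finite L" "card L = a + b"
  shows "card {A. A \<subseteq> L \<and> card A = a \<and> leads_by L z r A} \<le> (a + b) choose (b + r)"
  using assms
proof (induction "card L" arbitrary: L a b r)
  case 0
  then have "L = {}" by simp
  then have *: "{A. A \<subseteq> L \<and> card A = a \<and> leads_by L z r A} = (if r = 0 \<and> a = 0 then {{}} else {})"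
    by (auto simp: leads_by_def)
  show ?case unfolding * using 0 by auto
next
  case (Suc N)
  let ?R = "\<lambda>L a r. {A. A \<subseteq> L \<and> card A = a \<and> leads_by L z r A}"
  have finR: "finite (?R L a r)" if "finite L" for L a r
    using that by (auto intro: finite_subset[of _ "Pow L"])
  show ?case
  \<comment> \<open>At height 0 the bound is the number of all subsets of size \<open>a\<close>; a
    recursion on the first step makes sense only for positive height.\<close>
  proof (cases "r = 0")
    case True
    have "card (?R L a r) \<le> card {A. A \<subseteq> L \<and> card A = a}"
      using Suc.prems by (intro card_mono) (auto intro: finite_subset[of _ "Pow L"])
    also have "\<dots> = (a + b) choose a" using Suc.prems by (simp add: n_subsets)
    also have "\<dots> = (a + b) choose b" using binomial_symmetric[of a "a + b"] by simp
    finally show ?thesis using True by simp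
  next
    case False
    then obtain r' where r': "r = Suc r'" by (cases r) auto
    have ne: "L \<noteq> {}" using Suc by auto
    \<comment> \<open>A point of smallest value is the first step of the path.\<close>
    have "Min (z ` L) \<in> z ` L" using Suc.prems ne by (intro Min_in) auto
    then obtain x where x: "x \<in> L" "z x = Min (z ` L)" by auto
    have xmin: "z x \<le> z l" if "l \<in> L" for l
      using that Suc.prems x by simp
    define L' where "L' = L - {x}"
    have L': "finite L'" "N = card L'" "L = insert x L'" "x \<notin> L'"
      using x Suc unfolding L'_def by auto
    \<comment> \<open>A positive lead is attained at a sample point, hence at a threshold that
      already counts \<open>x\<close>. So \<open>x\<close> inside \<open>A\<close> lowers the height
      still to be reached by one, and \<open>x\<close> outside raises it by one.\<close>
    have first: "\<exists>q\<ge>z x. card {l \<in> L - A. z l \<le> q} + r \<le> card {l \<in> A. z l \<le> q}"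
      if A: "A \<subseteq> L" "leads_by L z r A" for A
    proof -
      have "\<exists>t\<in>L. card {l \<in> L - A. z l \<le> z t} + r \<le> card {l \<in> A. z l \<le> z t}"
        using A False Suc.prems by (subst leads_by_iff_sample_point[symmetric]) auto
      then show ?thesis using xmin by blast
    qed
    have leads_in: "leads_by L' z r' (A - {x})"
      if A: "A \<subseteq> L" "x \<in> A" "leads_by L z r A" for A
    proof -
      obtain q where q: "z x \<le> q" "card {l \<in> L - A. z l \<le> q} + r \<le> card {l \<in> A. z l \<le> q}"
        using first A by blast
      have e: "{l \<in> A. z l \<le> q} = insert x {l \<in> A - {x}. z l \<le> q}" "L' - (A - {x}) = L - A"
        using A q L' by auto
      have "finite A" using A Suc.prems finite_subset by auto
      then have "card {l \<in> A. z l \<le> q} = Suc (card {l \<in> A - {x}. z l \<le> q})"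
        unfolding e by simp
      then show ?thesis using q e r' unfolding leads_by_def by auto
    qed
    have leads_out: "leads_by L' z (Suc r) A"
      if A: "A \<subseteq> L" "x \<notin> A" "leads_by L z r A" for A
    proof -
      obtain q where q: "z x \<le> q" "card {l \<in> L - A. z l \<le> q} + r \<le> card {l \<in> A. z l \<le> q}"
        using first A by blast
      have e: "{l \<in> L - A. z l \<le> q} = insert x {l \<in> L' - A. z l \<le> q}"
        using A q L' by auto
      have "card {l \<in> L - A. z l \<le> q} = Suc (card {l \<in> L' - A. z l \<le> q})"
        unfolding e using L' by simp
      then show ?thesis using q unfolding leads_by_def by auto
    qed
    \<comment> \<open>The case \<open>a = 0\<close> is separate because \<open>A\<close> is then
      empty and cannot contain \<open>x\<close>. Dually, in \<open>Out\<close> the case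
      \<open>b = 0\<close> forces \<open>A = L\<close>, which does contain \<open>x\<close>.\<close>
    have In: "card {A \<in> ?R L a r. x \<in> A} \<le> (a + b - 1) choose (b + r - 1)"
    proof (cases a)
      case 0
      have "A = {}" if "A \<subseteq> L" "card A = a" for A
        using that 0 finite_subset[OF that(1) Suc.prems(1)] by simp
      then have *: "{A \<in> ?R L a r. x \<in> A} = {}" by blast
      show ?thesis unfolding * by simp
    next
      case (Suc a')
      have "card {A \<in> ?R L a r. x \<in> A} \<le> card (?R L' a' r')"
      proof (rule card_inj_on_le[where f = "\<lambda>A. A - {x}"])
        show "inj_on (\<lambda>A. A - {x}) {A \<in> ?R L a r. x \<in> A}"
          by (auto simp: inj_on_def)
        show "(\<lambda>A. A - {x}) ` {A \<in> ?R L a r. x \<in> A} \<subseteq> ?R L' a' r'"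
          using leads_in Suc L'_def by auto
      qed (use finR L' in auto)
      also have "\<dots> \<le> (a' + b) choose (b + r')"
        using Suc.hyps(1)[OF L'(2), of a' b r'] L' Suc Suc.prems by auto
      finally show ?thesis using Suc r' by simp
    qed
    have Out: "card {A \<in> ?R L a r. x \<notin> A} \<le> (a + b - 1) choose (b + r)"
    proof (cases b)
      case 0
      have "A = L" if "A \<subseteq> L" "card A = a" for A
        using that 0 Suc.prems(2) by (intro card_subset_eq[OF Suc.prems(1)]) auto
      then have *: "{A \<in> ?R L a r. x \<notin> A} = {}" using x by auto
      show ?thesis unfolding * by simp
    next
      case (Suc b')
      have "card {A \<in> ?R L a r. x \<notin> A} \<le> card (?R L' a (Suc r))"
        using leads_out finR L' by (intro card_mono) auto
      also have "\<dots> \<le> (a + b') choose (b' + Suc r)"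
        using Suc.hyps(1)[OF L'(2), of a b' "Suc r"] L' Suc Suc.prems by auto
      finally show ?thesis using Suc by simp
    qed
    have "?R L a r = {A \<in> ?R L a r. x \<in> A} \<union> {A \<in> ?R L a r. x \<notin> A}" by blast
    from arg_cong[where f = card, OF this] card_Un_le
    have "card (?R L a r) \<le> card {A \<in> ?R L a r. x \<in> A} + card {A \<in> ?R L a r. x \<notin> A}"
      by (rule ord_eq_le_trans)
    also have "\<dots> \<le> ((a + b - 1) choose (b + r - 1)) + ((a + b - 1) choose (b + r))"
      using In Out by simp
    \<comment> \<open>A first down-step changes \<open>b\<close> to \<open>b - 1\<close> and
      \<open>r\<close> to \<open>r + 1\<close>, which keeps the lower index; a first up-step reduces
      it by one. These are the two terms of Pascal's rule.\<close>
    also have "\<dots> = (a + b) choose (b + r)"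
      using Suc.hyps(2) Suc.prems r' by (cases "a + b") auto
    finally show ?thesis .
  qed
qed

section \<open>Tail sums of central binomial coefficients\<close>

text \<open>Writing \<open>2 * r\<close> as \<open>(m + r) - (m - r)\<close> and absorbing both
  factors turns each term into \<open>2 * m\<close> times a difference of neighbouring entries of
  row \<open>2 * m - 1\<close>, so the sum telescopes.\<close>

lemma sum_central_binomial_tail:
  "(\<Sum>r=1..m. 2 * r * ((2 * m) choose (m + r))) = m * ((2 * m) choose m)"
proof (cases m)
  case (Suc k)
  \<comment> \<open>The difference is stated additively to avoid truncated subtraction on the
    naturals.\<close>
  have step: "2 * r * ((2 * m) choose (m + r)) + 2 * m * ((2*m-1) choose (m + r))
     = 2 * m * ((2*m-1) choose (m + r - 1))" if "r \<in> {1..m}" for r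
  proof -
    have 1: "(m + r) * ((2 * m) choose (m + r)) = 2 * m * ((2*m-1) choose (m + r - 1))"
      using binomial_absorption[of "m + r - 1" "2 * m"] Suc by simp
    have 2: "(m - r) * ((2 * m) choose (m + r)) = 2 * m * ((2*m-1) choose (m + r))"
      using binomial_absorb_comp[of "2 * m" "m + r"] that by auto
    have "m + r = 2 * r + (m - r)" using that by auto
    then have "(m + r) * ((2 * m) choose (m + r))
        = 2 * r * ((2 * m) choose (m + r)) + (m - r) * ((2 * m) choose (m + r))"
      by (simp only: add_mult_distrib[symmetric])
    then show ?thesis unfolding 1 2 by (rule sym)
  qed
  have tel: "(\<Sum>r=1..j. 2 * r * ((2 * m) choose (m + r))) + 2 * m * ((2*m-1) choose (m + j))
     = 2 * m * ((2*m-1) choose m)" if "j \<le> m" for j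
    using that
  proof (induction j)
    case (Suc j)
    then show ?case using step[of "Suc j"] by simp
  qed simp
  \<comment> \<open>The remainder of the telescope lies beyond the end of the row.\<close>
  have "(2*m-1) choose (m + m) = 0" using Suc by simp
  then have "(\<Sum>r=1..m. 2 * r * ((2 * m) choose (m + r))) = 2 * m * ((2*m-1) choose m)"
    using tel[OF order.refl] by (simp only: mult_0_right add_0_right)
  also have "\<dots> = m * ((2 * m) choose m)"
    using binomial_absorb_comp[of "2 * m" m] by auto
  finally show ?thesis .
qed simp

text \<open>From the tail sum with weights \<open>2 * r\<close>, the plain tail sum is subtracted
  and only its first term \<open>(2 * m) choose (m + 1)\<close> is kept, which is
  \<open>m / (m + 1)\<close> times the central coefficient. This gain yields
  \<open>1 / (m + 1)\<close> instead of \<open>1 / m\<close> later on, the form that averages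
  exactly against binomial weights.\<close>

lemma sum_odd_central_binomial_tail_le:
  assumes "0 < m"
  shows "(\<Sum>r=1..m. (2 * real r - 1) * real ((2 * m) choose (m + r)))
    \<le> real m ^ 2 / (real m + 1) * real ((2 * m) choose m)"
proof -
  have "(\<Sum>r=1..m. (2 * real r - 1) * real ((2 * m) choose (m + r)))
    = real (\<Sum>r=1..m. 2 * r * ((2 * m) choose (m + r))) - (\<Sum>r=1..m. real ((2 * m) choose (m + r)))"
    by (simp add: sum_subtractf left_diff_distrib)
  also have "\<dots> = real m * real ((2 * m) choose m) - (\<Sum>r=1..m. real ((2 * m) choose (m + r)))"
    unfolding sum_central_binomial_tail by simp
  also have "\<dots> \<le> real m * real ((2 * m) choose m) - real ((2 * m) choose (m + 1))"
    using assms by (intro diff_left_mono member_le_sum) auto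
  also have "\<dots> = real m ^ 2 / (real m + 1) * real ((2 * m) choose m)"
  proof -
    have "(m + 1) * ((2 * m) choose (m + 1)) = m * ((2 * m) choose m)"
      using binomial_absorption[of m "2 * m"] binomial_absorb_comp[of "2 * m" m] assms by simp
    then have "real (m + 1) * real ((2 * m) choose (m + 1)) = real m * real ((2 * m) choose m)"
      by (simp only: of_nat_mult[symmetric])
    then have "real ((2 * m) choose (m + 1)) = real m * real ((2 * m) choose m) / (real m + 1)"
      by (simp add: field_simps)
    then show ?thesis by (simp add: field_simps power2_eq_square)
  qed
  finally show ?thesis .
qed

text \<open>
  Layer-cake form of the squared maximal lead of either side: it dominates the squared difference of
  the counts at every threshold, yet it is a finite, hence measurable, expression in the sample.
\<close>
definition dev_bound :: "'i set \<Rightarrow> nat \<Rightarrow> ('i \<Rightarrow> real) \<Rightarrow> 'i set \<Rightarrow> real" where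
  "dev_bound L m z A = (\<Sum>r=1..m. (2 * real r - 1) *
     (of_bool (leads_by L z r A) + of_bool (leads_by L z r (L - A))))"

lemma sum_odd_eq_square: "(\<Sum>r=1..d. 2 * real r - 1) = real d ^ 2"
  by (induction d) (auto simp: power2_eq_square algebra_simps)

text \<open>The first \<open>d\<close> odd numbers are the layers of a square, and every one of
  these layers has indicator 1.\<close>

lemma square_le_sum_odd:
  assumes "d \<le> m" "\<And>r. r \<in> {1..d} \<Longrightarrow> P r"
  shows "real d ^ 2 \<le> (\<Sum>r=1..m. (2 * real r - 1) * of_bool (P r))"
proof -
  have "real d ^ 2 = (\<Sum>r=1..d. (2 * real r - 1) * of_bool (P r))"
    unfolding sum_odd_eq_square[symmetric] using assms by (intro sum.cong) auto
  also have "\<dots> \<le> (\<Sum>r=1..m. (2 * real r - 1) * of_bool (P r))"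
    using assms by (intro sum_mono2) auto
  finally show ?thesis .
qed

text \<open>A difference of counts \<open>d\<close> at \<open>q\<close> is a lead by every
  \<open>r\<close> up to \<open>d\<close>, for \<open>A\<close> or for its complement according to
  the sign. Both parts having at most \<open>m\<close> points keeps \<open>d\<close> within the
  truncated sum.\<close>

lemma square_diff_le_dev_bound:
  assumes "finite L" "A \<subseteq> L" "card A \<le> m" "card (L - A) \<le> m"
  shows "(real (card {l \<in> A. z l \<le> q}) - real (card {l \<in> L - A. z l \<le> q}))\<^sup>2 \<le> dev_bound L m z A"
proof -
  let ?a = "card {l \<in> A. z l \<le> q}" and ?b = "card {l \<in> L - A. z l \<le> q}"
  have LA: "L - (L - A) = A" using assms by auto
  have fA: "finite A" using assms finite_subset by auto
  have "?a \<le> card A" "?b \<le> card (L - A)"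
    using assms fA by (auto intro!: card_mono)
  then have ab: "?a \<le> m" "?b \<le> m" using assms by auto
  have split: "dev_bound L m z A = (\<Sum>r=1..m. (2 * real r - 1) * of_bool (leads_by L z r A))
     + (\<Sum>r=1..m. (2 * real r - 1) * of_bool (leads_by L z r (L - A)))"
    unfolding dev_bound_def by (simp add: distrib_left sum.distrib)
  have nn: "0 \<le> (\<Sum>r=1..m. (2 * real r - 1) * of_bool (P r))" for P :: "nat \<Rightarrow> bool"
    by (intro sum_nonneg) auto
  show ?thesis
  proof (cases "?b \<le> ?a")
    case True
    have "real (?a - ?b) ^ 2 \<le> (\<Sum>r=1..m. (2 * real r - 1) * of_bool (leads_by L z r A))"
      using ab True unfolding leads_by_def by (intro square_le_sum_odd) (auto intro!: exI[of _ q])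
    then show ?thesis using split nn[of "\<lambda>r. leads_by L z r (L - A)"] True by (simp add: of_nat_diff)
  next
    case False
    have "real (?b - ?a) ^ 2 \<le> (\<Sum>r=1..m. (2 * real r - 1) * of_bool (leads_by L z r (L - A)))"
      using ab False unfolding leads_by_def by (intro square_le_sum_odd) (auto intro!: exI[of _ q] simp: LA)
    then show ?thesis using split nn[of "\<lambda>r. leads_by L z r A"] False
      by (simp add: of_nat_diff power2_commute)
  qed
qed

lemma dev_bound_nonneg: "0 \<le> dev_bound L m z A"
  unfolding dev_bound_def by (intro sum_nonneg mult_nonneg_nonneg) auto

lemma dev_bound_le: "dev_bound L m z A \<le> 2 * real m ^ 2"
proof -
  have "dev_bound L m z A \<le> (\<Sum>r=1..m. (2 * real r - 1) * 2)"
    unfolding dev_bound_def by (intro sum_mono mult_left_mono) auto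
  also have "\<dots> = 2 * real m ^ 2"
    unfolding sum_odd_eq_square[symmetric] by (simp add: sum_distrib_left mult.commute)
  finally show ?thesis .
qed

lemma abs_dev_bound_le: "\<bar>dev_bound L m z A\<bar> \<le> 2 * real m ^ 2"
  using dev_bound_le dev_bound_nonneg by (metis abs_of_nonneg)

text \<open>After exchanging the sums, each layer counts the halves that ever lead by
  \<open>r\<close>, which the reflection bound with \<open>a = b = m\<close> controls. The two sides
  contribute equally, whence the factor 2.\<close>

lemma sum_dev_bound_le:
  assumes "finite L" "card L = 2 * m" "0 < m"
  shows "(\<Sum>A | A \<subseteq> L \<and> card A = m. dev_bound L m z A)
    \<le> 2 * real m ^ 2 / (real m + 1) * real ((2 * m) choose m)"
proof -
  let ?H = "{A. A \<subseteq> L \<and> card A = m}"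
  have fin: "finite ?H" using assms by (auto intro: finite_subset[of _ "Pow L"])
  have count: "(\<Sum>A\<in>?H. of_bool (leads_by L z r A)) \<le> real ((2 * m) choose (m + r))" for r
  proof -
    have "(\<Sum>A\<in>?H. of_bool (leads_by L z r A)) = real (card {A. A \<subseteq> L \<and> card A = m \<and> leads_by L z r A})"
      using fin by (simp add: of_bool_def sum.If_cases Int_def conj_assoc)
    also have "\<dots> \<le> real ((2 * m) choose (m + r))"
      using card_leads_by_le[of L m m z r] assms by (simp add: mult_2)
    finally show ?thesis .
  qed
  \<comment> \<open>Complementation is an involution on the halves of \<open>L\<close>.\<close>
  have compl: "(\<Sum>A\<in>?H. of_bool (leads_by L z r (L - A))) = (\<Sum>A\<in>?H. of_bool (leads_by L z r A) :: real)" for r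
    using assms
    by (intro sum.reindex_bij_witness[of _ "\<lambda>A. L - A" "\<lambda>A. L - A"])
       (auto simp: card_Diff_subset finite_subset double_diff)
  have "(\<Sum>A\<in>?H. dev_bound L m z A) = (\<Sum>r=1..m. \<Sum>A\<in>?H. (2 * real r - 1) *
     (of_bool (leads_by L z r A) + of_bool (leads_by L z r (L - A))))"
    unfolding dev_bound_def by (rule sum.swap)
  also have "\<dots> = (\<Sum>r=1..m. (2 * real r - 1) * (2 * (\<Sum>A\<in>?H. of_bool (leads_by L z r A))))"
    by (simp add: sum_distrib_left[symmetric] sum.distrib compl)
  also have "\<dots> \<le> (\<Sum>r=1..m. (2 * real r - 1) * (2 * real ((2 * m) choose (m + r))))"
    using count by (intro sum_mono mult_left_mono) auto
  also have "\<dots> = 2 * (\<Sum>r=1..m. (2 * real r - 1) * real ((2 * m) choose (m + r)))"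
    by (simp add: sum_distrib_left mult_ac)
  also have "\<dots> \<le> 2 * (real m ^ 2 / (real m + 1) * real ((2 * m) choose m))"
    using sum_odd_central_binomial_tail_le[OF assms(3)] by simp
  finally show ?thesis by simp
qed

section \<open>Uniform deviation of an i.i.d. sample\<close>

text \<open>Permuting the coordinates of the sample amounts to moving the chosen subset. The
  restriction to \<open>L\<close> matches the extensional functions of the product space.\<close>

lemma leads_by_reindex:
  assumes "bij_betw p L L" "B \<subseteq> L"
  shows "leads_by L (\<lambda>l\<in>L. z (p l)) r B = leads_by L z r (p ` B)"
proof -
  have inj: "inj_on p L" and im: "p ` L = L" using assms by (auto simp: bij_betw_def)
  have card: "card {l \<in> C. (\<lambda>l\<in>L. z (p l)) l \<le> q} = card {l \<in> p ` C. z l \<le> q}" if "C \<subseteq> L" for C q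
  proof -
    have "{l \<in> p ` C. z l \<le> q} = p ` {l \<in> C. (\<lambda>l\<in>L. z (p l)) l \<le> q}" using that by auto
    moreover have "inj_on p {l \<in> C. (\<lambda>l\<in>L. z (p l)) l \<le> q}"
      using inj that by (auto intro: inj_on_subset)
    ultimately show ?thesis by (simp add: card_image)
  qed
  have "p ` (L - B) = L - p ` B" using inj im assms(2) by (simp add: inj_on_image_set_diff)
  then show ?thesis unfolding leads_by_def using card[of B] card[of "L - B"] assms(2) by simp
qed

lemma dev_bound_reindex:
  assumes "bij_betw p L L" "B \<subseteq> L"
  shows "dev_bound L m (\<lambda>l\<in>L. z (p l)) B = dev_bound L m z (p ` B)"
proof -
  have "p ` (L - B) = L - p ` B"
    using assms inj_on_image_set_diff[of p L L B] by (simp add: bij_betw_def)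
  then show ?thesis using leads_by_reindex[OF assms(1)] assms(2)
    unfolding dev_bound_def by simp
qed

text \<open>The threshold in \<open>leads_by\<close> ranges over the uncountable reals; replacing it
  by sample points leaves a finite union of comparisons between sums of indicators.\<close>

lemma measurable_dev_bound:
  assumes "finite L" "A \<subseteq> L" and "sets \<mu> = sets borel"
  shows "(\<lambda>z. dev_bound L m z A) \<in> borel_measurable (Pi\<^sub>M L (\<lambda>_. \<mu>))"
proof -
  have comp: "(\<lambda>z. z l) \<in> borel_measurable (Pi\<^sub>M L (\<lambda>_. \<mu>))" if "l \<in> L" for l
    using measurable_component_singleton[OF that, of "\<lambda>_. \<mu>"] measurable_cong_sets[OF refl assms(3)] by blast
  have [measurable]: "Measurable.pred (Pi\<^sub>M L (\<lambda>_. \<mu>)) (\<lambda>z. leads_by L z r B)" if "0 < r" "B \<subseteq> L" for r B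
  proof -
    have card: "real (card {l \<in> C. z l \<le> z t}) = (\<Sum>l\<in>C. if z l \<le> z t then 1 else 0)"
      if "finite C" for C and z :: "'a \<Rightarrow> real" and t
      using that by (simp add: sum.If_cases Int_def)
    have meas: "(\<lambda>z. \<Sum>l\<in>C. if z l \<le> z t then 1 else 0 :: real) \<in> borel_measurable (Pi\<^sub>M L (\<lambda>_. \<mu>))"
      if "C \<subseteq> L" "t \<in> L" for C t
    proof (intro borel_measurable_sum)
      fix l assume "l \<in> C"
      then have [measurable]: "(\<lambda>z. z l) \<in> borel_measurable (Pi\<^sub>M L (\<lambda>_. \<mu>))"
          "(\<lambda>z. z t) \<in> borel_measurable (Pi\<^sub>M L (\<lambda>_. \<mu>))"
        using comp that by auto
      show "(\<lambda>z. if z l \<le> z t then 1 else 0 :: real) \<in> borel_measurable (Pi\<^sub>M L (\<lambda>_. \<mu>))"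
        by measurable
    qed
    have finB: "finite B" "finite (L - B)" using that assms finite_subset by auto
    have eq: "leads_by L z r B \<longleftrightarrow> (\<exists>t\<in>L. (\<Sum>l\<in>L - B. if z l \<le> z t then 1 else 0) + real r
        \<le> (\<Sum>l\<in>B. if z l \<le> z t then 1 else 0))" for z
      unfolding leads_by_iff_sample_point[OF assms(1) that(2,1)]
        card[OF finB(1), symmetric] card[OF finB(2), symmetric] by (simp flip: of_nat_add)
    show ?thesis unfolding eq
    proof (intro pred_intros_finite assms)
      fix t assume "t \<in> L"
      show "Measurable.pred (Pi\<^sub>M L (\<lambda>_. \<mu>)) (\<lambda>z. (\<Sum>l\<in>L - B. if z l \<le> z t then 1 else 0) + real r
        \<le> (\<Sum>l\<in>B. if z l \<le> z t then 1 else 0))"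
        unfolding pred_def using meas that(2) \<open>t \<in> L\<close>
        by (intro borel_measurable_le borel_measurable_add borel_measurable_const) auto
    qed
  qed
  show ?thesis unfolding dev_bound_def of_bool_def
  proof (intro borel_measurable_sum)
    fix r assume "r \<in> {1..m}"
    then have [measurable]: "Measurable.pred (Pi\<^sub>M L (\<lambda>_. \<mu>)) (\<lambda>z. leads_by L z r A)"
      "Measurable.pred (Pi\<^sub>M L (\<lambda>_. \<mu>)) (\<lambda>z. leads_by L z r (L - A))" using assms by auto
    show "(\<lambda>z. (2 * real r - 1) * ((if leads_by L z r A then 1 else 0) + (if leads_by L z r (L - A) then 1 else 0)))
       \<in> borel_measurable (Pi\<^sub>M L (\<lambda>_. \<mu>))" by measurable
  qed
qed

text \<open>Exchangeability: the integral is the same for every half, so it equals the average over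
  all halves, and that average is bounded pointwise for each fixed sample.\<close>

lemma integral_dev_bound_le:
  assumes \<mu>: "prob_space \<mu>" and bor: "sets \<mu> = sets borel"
    and L: "finite L" "card L = 2 * m" "0 < m" and J: "J \<subseteq> L" "card J = m"
  shows "(\<integral>z. dev_bound L m z J \<partial>Pi\<^sub>M L (\<lambda>_. \<mu>)) \<le> 2 * real m ^ 2 / (real m + 1)"
proof -
  let ?P = "Pi\<^sub>M L (\<lambda>_. \<mu>)"
  let ?H = "{A. A \<subseteq> L \<and> card A = m}"
  interpret P: prob_space ?P using \<mu> by (intro prob_space_PiM)
  have meas: "(\<lambda>z. dev_bound L m z A) \<in> borel_measurable ?P" if "A \<subseteq> L" for A
    using that L bor by (intro measurable_dev_bound)
  have int: "integrable ?P (\<lambda>z. dev_bound L m z A)" if "A \<subseteq> L" for A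
    using meas[OF that]
    by (intro P.integrable_const_bound[where B = "2 * real m ^ 2"] AE_I2) (simp_all add: abs_dev_bound_le)
  have sym: "(\<integral>z. dev_bound L m z A \<partial>?P) = (\<integral>z. dev_bound L m z J \<partial>?P)" if A: "A \<in> ?H" for A
  proof -
    have fin: "finite J" "finite A" using J A L finite_subset by auto
    obtain p1 where p1: "bij_betw p1 J A"
      using finite_same_card_bij[OF fin] J A by auto
    obtain p2 where p2: "bij_betw p2 (L - J) (L - A)"
      using finite_same_card_bij[of "L - J" "L - A"] J A L fin by (auto simp: card_Diff_subset)
    \<comment> \<open>Gluing a bijection from \<open>J\<close> to \<open>A\<close> with one between
      the complements gives a permutation of \<open>L\<close> that carries \<open>J\<close> onto
      \<open>A\<close> and preserves the product measure.\<close>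
    define p where "p l = (if l \<in> J then p1 l else p2 l)" for l
    have pJ: "bij_betw p J A" using p1 by (subst bij_betw_cong[of J p p1]) (auto simp: p_def)
    moreover have "bij_betw p (L - J) (L - A)"
      using p2 by (subst bij_betw_cong[of "L - J" p p2]) (auto simp: p_def)
    ultimately have "bij_betw p (J \<union> (L - J)) (A \<union> (L - A))"
      by (intro bij_betw_combine) auto
    then have p: "bij_betw p L L" using J A by (simp add: Un_absorb1)
    have pJA: "p ` J = A" using pJ by (simp add: bij_betw_def)
    have d: "distr ?P ?P (\<lambda>\<omega>. \<lambda>l\<in>L. \<omega> (p l)) = ?P"
      using distr_PiM_reindex[of L "\<lambda>_. \<mu>" p L] \<mu> p by (auto simp: bij_betw_def)
    have pm: "(\<lambda>\<omega>. \<lambda>l\<in>L. \<omega> (p l)) \<in> measurable ?P ?P"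
      using p by (intro measurable_restrict measurable_component_singleton) (auto simp: bij_betw_def)
    have "(\<integral>z. dev_bound L m z J \<partial>?P) = (\<integral>z. dev_bound L m z J \<partial>distr ?P ?P (\<lambda>\<omega>. \<lambda>l\<in>L. \<omega> (p l)))"
      unfolding d ..
    also have "\<dots> = (\<integral>z. dev_bound L m (\<lambda>l\<in>L. z (p l)) J \<partial>?P)"
      using pm meas J by (intro integral_distr) auto
    also have "\<dots> = (\<integral>z. dev_bound L m z A \<partial>?P)"
      unfolding dev_bound_reindex[OF p J(1)] pJA ..
    finally show ?thesis ..
  qed
  have cH: "card ?H = (2 * m) choose m" using n_subsets[of L m] L by simp
  have "real ((2 * m) choose m) * (\<integral>z. dev_bound L m z J \<partial>?P) = (\<Sum>A\<in>?H. \<integral>z. dev_bound L m z A \<partial>?P)"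
    using sym cH by simp
  also have "\<dots> = (\<integral>z. (\<Sum>A\<in>?H. dev_bound L m z A) \<partial>?P)"
    using int by (intro Bochner_Integration.integral_sum[symmetric]) auto
  also have "\<dots> \<le> (\<integral>z. 2 * real m ^ 2 / (real m + 1) * real ((2 * m) choose m) \<partial>?P)"
    using sum_dev_bound_le[OF L] int by (intro integral_mono) auto
  also have "\<dots> = real ((2 * m) choose m) * (2 * real m ^ 2 / (real m + 1))"
    by (simp add: P.prob_space)
  finally show ?thesis by (subst (asm) mult_le_cancel_left_pos) auto
qed

section \<open>Symmetrization by a ghost sample\<close>

text \<open>The true distribution function is the mean of the empirical one of a ghost sample, so
  Jensen's inequality moves the square inside that mean. One measurable majorant \<open>G\<close>
  for all \<open>q\<close> replaces the supremum, so no measurability of a supremum over real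
  thresholds is involved.\<close>

lemma empirical_cdf_square_dominated:
  fixes \<mu> :: "real measure" and J :: "nat set"
  assumes \<mu>: "prob_space \<mu>" and bor: "sets \<mu> = sets borel"
    and J: "finite J" "card J = m" "0 < m"
  shows "\<exists>G \<in> borel_measurable (Pi\<^sub>M J (\<lambda>_. \<mu>)). (\<forall>z. 0 \<le> G z) \<and>
    (\<forall>z \<in> space (Pi\<^sub>M J (\<lambda>_. \<mu>)). \<forall>q. (card {l \<in> J. z l \<le> q} / m - measure \<mu> {..q})\<^sup>2 \<le> G z) \<and>
    (\<integral>\<^sup>+z. ennreal (G z) \<partial>Pi\<^sub>M J (\<lambda>_. \<mu>)) \<le> ennreal (2 / (real m + 1))"
proof -
  \<comment> \<open>Ghost indices are taken outside \<open>J\<close>, so that both samples merge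
    into one product over the union.\<close>
  obtain J' where J': "finite J'" "card J' = m" "J' \<subseteq> UNIV - J"
    using infinite_arbitrarily_large[of "UNIV - J" m] J(1) by (auto simp: Diff_infinite_finite)
  let ?L = "J \<union> J'" and ?P = "Pi\<^sub>M J (\<lambda>_. \<mu>)" and ?P' = "Pi\<^sub>M J' (\<lambda>_. \<mu>)"
  let ?D = "\<lambda>w. dev_bound ?L m w J"
  have "J \<inter> J' = {}" using J' by auto
  then have L: "finite ?L" "card ?L = 2 * m" "J \<inter> J' = {}" "?L - J = J'"
    using J J' card_Un_disjoint[of J J'] by auto
  interpret \<mu>: prob_space \<mu> by fact
  interpret prod: product_sigma_finite "\<lambda>_::nat. \<mu>" by standard
  interpret P: prob_space ?P using \<mu> by (intro prob_space_PiM)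
  interpret P': prob_space ?P' using \<mu> by (intro prob_space_PiM)
  have Dm: "?D \<in> borel_measurable (Pi\<^sub>M ?L (\<lambda>_. \<mu>))"
    using L bor by (intro measurable_dev_bound) auto
  have Dpair: "(\<lambda>x. ?D (merge J J' x)) \<in> borel_measurable (?P \<Otimes>\<^sub>M ?P')"
    using measurable_merge Dm by (rule measurable_compose)
  have Dz: "(\<lambda>z'. ?D (merge J J' (z, z'))) \<in> borel_measurable ?P'" if "z \<in> space ?P" for z
    using measurable_compose[OF measurable_Pair1'[OF that] Dpair] .
  have Dint: "integrable ?P' (\<lambda>z'. ?D (merge J J' (z, z')))" if "z \<in> space ?P" for z
    using Dz[OF that]
    by (intro P'.integrable_const_bound[where B = "2 * real m ^ 2"] AE_I2) (simp_all add: abs_dev_bound_le)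
  \<comment> \<open>Integrating out the ghost coordinates leaves a function of the given sample that
    does not mention \<open>q\<close>.\<close>
  define G where "G z = (\<integral>z'. ?D (merge J J' (z, z')) \<partial>?P') / (real m)\<^sup>2" for z
  have Gm: "G \<in> borel_measurable ?P"
    unfolding G_def using P'.borel_measurable_lebesgue_integral[of "\<lambda>z z'. ?D (merge J J' (z, z'))" ?P] Dpair
    by (intro borel_measurable_divide) (auto simp: case_prod_beta')
  have G0: "0 \<le> G z" for z
    unfolding G_def by (intro divide_nonneg_nonneg Bochner_Integration.integral_nonneg dev_bound_nonneg) auto
  have G2: "G z \<le> 2" if "z \<in> space ?P" for z
  proof -
    have "(\<integral>z'. ?D (merge J J' (z, z')) \<partial>?P') \<le> (\<integral>z'. 2 * real m ^ 2 \<partial>?P')"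
      using Dint[OF that] dev_bound_le by (intro integral_mono) auto
    then show ?thesis unfolding G_def using J by (simp add: P'.prob_space divide_le_eq)
  qed
  have dom: "(card {l \<in> J. z l \<le> q} / m - measure \<mu> {..q})\<^sup>2 \<le> G z" if z: "z \<in> space ?P" for z q
  proof -
    have coord: "integrable ?P' (\<lambda>z'. indicator {..q} (z' l) :: real)"
      "(\<integral>z'. indicator {..q} (z' l) \<partial>?P') = measure \<mu> {..q}" if "l \<in> J'" for l
    proof -
      have m1: "(\<lambda>z'. z' l) \<in> measurable ?P' \<mu>"
        using that by (intro measurable_component_singleton)
      have ind: "(indicator {..q} :: real \<Rightarrow> real) \<in> borel_measurable \<mu>" using bor by simp
      show "integrable ?P' (\<lambda>z'. indicator {..q} (z' l) :: real)"
        using measurable_compose[OF m1 ind]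
        by (intro P'.integrable_const_bound[where B = 1]) auto
      have "(\<integral>z'. indicator {..q} (z' l) \<partial>?P') = (\<integral>x. indicat_real {..q} x \<partial>distr ?P' \<mu> (\<lambda>z'. z' l))"
        using integral_distr[OF m1 ind] by (rule sym)
      also have "\<dots> = (\<integral>x. indicat_real {..q} x \<partial>\<mu>)"
        using distr_PiM_component[of J' "\<lambda>_. \<mu>" l] \<mu> that by simp
      finally show "(\<integral>z'. indicator {..q} (z' l) \<partial>?P') = measure \<mu> {..q}" 
        using bor sets_eq_imp_space_eq[OF bor] by simp
    qed
    define f where "f z' = card {l \<in> J. z l \<le> q} / m - (\<Sum>l\<in>J'. indicator {..q} (z' l)) / m" for z' :: "nat \<Rightarrow> real"
    have fint: "integrable ?P' f" unfolding f_def using coord by auto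
    have fE: "integral\<^sup>L ?P' f = card {l \<in> J. z l \<le> q} / m - measure \<mu> {..q}"
      unfolding f_def using coord J J' by (simp add: P'.prob_space)
    have count: "(\<Sum>l\<in>J'. indicator {..q} (z' l)) = real (card {l \<in> J'. z' l \<le> q})" for z' :: "nat \<Rightarrow> real"
      using J' by (simp add: indicator_def sum.If_cases Int_def)
    have fle: "(f z')\<^sup>2 \<le> ?D (merge J J' (z, z')) / (real m)\<^sup>2" for z'
    proof -
      have e: "{l \<in> J. merge J J' (z, z') l \<le> q} = {l \<in> J. z l \<le> q}"
        "{l \<in> ?L - J. merge J J' (z, z') l \<le> q} = {l \<in> J'. z' l \<le> q}"
        using L by (auto simp: merge_def)
      have "(real (card {l \<in> J. z l \<le> q}) - real (card {l \<in> J'. z' l \<le> q}))\<^sup>2 \<le> ?D (merge J J' (z, z'))"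
        using square_diff_le_dev_bound[of ?L J m "merge J J' (z, z')" q] L J J' unfolding e by auto
      then show ?thesis unfolding f_def count using J
        by (simp add: diff_divide_distrib[symmetric] power_divide divide_right_mono)
    qed
    have f2: "integrable ?P' (\<lambda>z'. (f z')\<^sup>2)"
    proof (rule Bochner_Integration.integrable_bound)
      show "integrable ?P' (\<lambda>z'. ?D (merge J J' (z, z')) / (real m)\<^sup>2)" using Dint[OF z] by simp
    qed (use fint fle in \<open>auto simp: abs_of_nonneg[OF dev_bound_nonneg]\<close>)
    \<comment> \<open>Jensen's inequality for the square, in the form that a variance is
      nonnegative.\<close>
    have "(integral\<^sup>L ?P' f)\<^sup>2 \<le> (\<integral>z'. (f z')\<^sup>2 \<partial>?P')"
      using P'.variance_eq[OF fint f2] P'.variance_positive[of f] by simp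
    also have "\<dots> \<le> (\<integral>z'. ?D (merge J J' (z, z')) / (real m)\<^sup>2 \<partial>?P')"
      using f2 Dint[OF z] fle by (intro integral_mono) auto
    also have "\<dots> = G z" unfolding G_def by simp
    finally show ?thesis unfolding fE .
  qed
  have Gint: "integrable ?P G"
    using Gm G0 G2 by (intro P.integrable_const_bound[where B = 2] AE_I2) auto
  have "integrable (Pi\<^sub>M ?L (\<lambda>_. \<mu>)) ?D"
  proof -
    interpret PL: prob_space "Pi\<^sub>M ?L (\<lambda>_. \<mu>)" using \<mu> by (intro prob_space_PiM)
    show ?thesis using Dm
      by (intro PL.integrable_const_bound[where B = "2 * real m ^ 2"] AE_I2) (simp_all add: abs_dev_bound_le)
  qed
  \<comment> \<open>Fubini: integrating \<open>G\<close> over the given sample restores the integral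
    over all \<open>2 * m\<close> coordinates.\<close>
  then have "(\<integral>w. ?D w \<partial>Pi\<^sub>M ?L (\<lambda>_. \<mu>)) = (\<integral>z. \<integral>z'. ?D (merge J J' (z, z')) \<partial>?P' \<partial>?P)"
    using L J J' by (intro prod.product_integral_fold) auto
  then have "(\<integral>z. G z \<partial>?P) = (\<integral>w. ?D w \<partial>Pi\<^sub>M ?L (\<lambda>_. \<mu>)) / (real m)\<^sup>2"
    unfolding G_def by simp
  also have "\<dots> \<le> 2 * real m ^ 2 / (real m + 1) / (real m)\<^sup>2"
    using \<mu> bor L J by (intro divide_right_mono integral_dev_bound_le) auto
  also have "\<dots> = 2 / (real m + 1)" using J by simp
  finally have "(\<integral>\<^sup>+z. ennreal (G z) \<partial>?P) \<le> ennreal (2 / (real m + 1))"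
    using Gint G0 by (subst nn_integral_eq_integral) (auto intro!: ennreal_leI)
  then show ?thesis using Gm G0 dom by blast
qed

section \<open>Averaging over a binomial sample size\<close>

text \<open>Absorption turns \<open>(n choose m) / (m + 1)\<close> into
  \<open>(Suc n choose Suc m) / (n + 1)\<close>, so the terms become binomial probabilities for
  \<open>Suc n\<close> trials with the outcome 0 missing; their total is at most 1.\<close>

lemma binomial_expectation_inverse_Suc_le:
  fixes p :: real
  assumes p: "0 < p" "p \<le> 1"
  shows "(\<Sum>m\<le>n. (n choose m) * p ^ m * (1 - p) ^ (n - m) * (2 / (real m + 1))) \<le> 2 / ((real n + 1) * p)"
proof -
  have t: "(n choose m) * p ^ m * (1 - p) ^ (n - m) * (2 / (real m + 1)) * ((real n + 1) * p)
    = 2 * ((Suc n choose Suc m) * p ^ Suc m * (1 - p) ^ (Suc n - Suc m))" for m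
  proof -
    have "(real m + 1) * real (Suc n choose Suc m) = (real n + 1) * real (n choose m)"
      using Suc_times_binomial_eq[of n m] by (metis mult.commute of_nat_Suc of_nat_mult add.commute)
    then have "real (Suc n choose Suc m) = (real n + 1) * real (n choose m) / (real m + 1)"
      by (simp add: field_simps)
    then show ?thesis by (simp only: power_Suc diff_Suc_Suc) (simp add: field_simps)
  qed
  have "(\<Sum>m\<le>n. (n choose m) * p ^ m * (1 - p) ^ (n - m) * (2 / (real m + 1))) * ((real n + 1) * p)
    = 2 * (\<Sum>m\<le>n. (Suc n choose Suc m) * p ^ Suc m * (1 - p) ^ (Suc n - Suc m))"
    unfolding sum_distrib_left sum_distrib_right t ..
  also have "\<dots> \<le> 2 * (\<Sum>k\<le>Suc n. (Suc n choose k) * p ^ k * (1 - p) ^ (Suc n - k))"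
    unfolding sum.atMost_Suc_shift[of _ n] using p by simp
  also have "\<dots> = 2" by (subst binomial_ring[symmetric]) simp
  finally show ?thesis using p by (simp add: pos_le_divide_eq)
qed

lemma sum_Pow_card:
  fixes h :: "nat \<Rightarrow> real"
  assumes "finite I"
  shows "(\<Sum>J\<in>Pow I. h (card J)) = (\<Sum>m\<le>card I. (card I choose m) * h m)"
proof -
  have "(\<Sum>J\<in>Pow I. h (card J)) = (\<Sum>m\<le>card I. \<Sum>J | J \<in> Pow I \<and> card J = m. h (card J))"
    using assms by (intro sum.group[symmetric]) (auto intro: card_mono)
  also have "\<dots> = (\<Sum>m\<le>card I. (card I choose m) * h m)"
    using assms by (intro sum.cong) (auto simp: n_subsets)
  finally show ?thesis .
qed

section \<open>Samples with a random subset of relevant points\<close>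

context prob_space
begin

lemma indep_vars_identical_rectangle:
  assumes I: "finite I" "I \<noteq> {}" and ind: "indep_vars (\<lambda>_. N) W I"
    and law: "\<And>l. l \<in> I \<Longrightarrow> distr M N (W l) = \<nu>" and B: "\<And>l. l \<in> I \<Longrightarrow> B l \<in> sets N"
  shows "prob {\<omega> \<in> space M. \<forall>l\<in>I. W l \<omega> \<in> B l} = (\<Prod>l\<in>I. measure \<nu> (B l))"
proof -
  have W: "W l \<in> measurable M N" if "l \<in> I" for l
    using ind that by (auto simp: indep_vars_def)
  have "{\<omega> \<in> space M. \<forall>l\<in>I. W l \<omega> \<in> B l} = (\<Inter>l\<in>I. W l -` B l \<inter> space M)"
    using I by auto
  also have "prob \<dots> = (\<Prod>l\<in>I. prob (W l -` B l \<inter> space M))"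
    using I B by (intro indep_varsD[OF ind]) auto
  also have "\<dots> = (\<Prod>l\<in>I. measure \<nu> (B l))"
    using measure_distr[OF W B] law by (intro prod.cong) auto
  finally show ?thesis .
qed

text \<open>The exact pattern of hits of \<open>V\<close> becomes a rectangle, the form to which
  independence applies.\<close>

lemma pattern_event_eq:
  assumes "\<And>l. l \<in> I \<Longrightarrow> W l \<in> measurable M N"
  shows "{\<omega> \<in> space M. \<forall>l\<in>I. W l \<omega> \<in> V \<longleftrightarrow> l \<in> J}
    = {\<omega> \<in> space M. \<forall>l\<in>I. W l \<omega> \<in> (if l \<in> J then V else space N - V)}"
  using measurable_space[OF assms] by auto

lemma pattern_event_in_events:
  assumes "finite I" and W: "\<And>l. l \<in> I \<Longrightarrow> W l \<in> measurable M N" and V: "V \<in> sets N"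
  shows "{\<omega> \<in> space M. \<forall>l\<in>I. W l \<omega> \<in> V \<longleftrightarrow> l \<in> J} \<in> events"
proof (subst pattern_event_eq[OF W], assumption, intro sets.sets_Collect_finite_All assms(1))
  fix l assume "l \<in> I"
  then show "{\<omega> \<in> space M. W l \<omega> \<in> (if l \<in> J then V else space N - V)} \<in> events"
    using measurable_sets[OF W, of l "if l \<in> J then V else space N - V"] V
    by (simp add: vimage_def Int_def conj_commute)
qed

text \<open>Given which points hit \<open>V\<close>, the values at these points are still i.i.d.,
  now with the law of \<open>f\<close> conditioned on \<open>V\<close>. It is enough to compare the
  two measures on rectangles.\<close>

lemma distr_conditioned_on_pattern:
  fixes f :: "'b \<Rightarrow> real" and W :: "nat \<Rightarrow> 'a \<Rightarrow> 'b"
  assumes I: "finite I" "I \<noteq> {}" and ind: "indep_vars (\<lambda>_. N) W I"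
    and law: "\<And>l. l \<in> I \<Longrightarrow> distr M N (W l) = \<nu>"
    and f: "f \<in> borel_measurable N" and V: "V \<in> sets N" and J: "J \<subseteq> I"
    and E: "E = {\<omega> \<in> space M. \<forall>l\<in>I. W l \<omega> \<in> V \<longleftrightarrow> l \<in> J}" and pos: "0 < prob E" "0 < measure \<nu> V"
  shows "distr (uniform_measure M E) (Pi\<^sub>M J (\<lambda>_. borel)) (\<lambda>\<omega>. \<lambda>l\<in>J. f (W l \<omega>))
    = Pi\<^sub>M J (\<lambda>_. distr (uniform_measure \<nu> V) borel f)"
proof -
  have W: "W l \<in> measurable M N" if "l \<in> I" for l
    using ind that by (auto simp: indep_vars_def)
  obtain l0 where l0: "l0 \<in> I" using I by auto
  have \<nu>: "prob_space \<nu>" "sets \<nu> = sets N" "space \<nu> = space N"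
    using prob_space_distr[OF W[OF l0]] law[OF l0] by auto
  interpret \<nu>: prob_space \<nu> by fact
  let ?\<mu> = "distr (uniform_measure \<nu> V) borel f"
  have fu: "f \<in> borel_measurable (uniform_measure \<nu> V)"
    using f \<nu> by (simp cong: measurable_cong_sets)
  have \<mu>: "prob_space ?\<mu>"
    using pos V \<nu> fu by (intro prob_space.prob_space_distr prob_space_uniform_measure)
      (auto simp: \<nu>.emeasure_eq_measure)
  interpret \<mu>: prob_space ?\<mu> by fact
  interpret prod: product_sigma_finite "\<lambda>_::nat. ?\<mu>" by standard
  have E_eq: "E = {\<omega> \<in> space M. \<forall>l\<in>I. W l \<omega> \<in> (if l \<in> J then V else space N - V)}"
    unfolding E by (rule pattern_event_eq[OF W])
  have Es: "E \<in> events" unfolding E using I(1) W V by (rule pattern_event_in_events)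
  have PE: "prob E = (\<Prod>l\<in>I. measure \<nu> (if l \<in> J then V else space N - V))"
    unfolding E_eq using V by (intro indep_vars_identical_rectangle[OF I ind law]) auto
  have meas: "(\<lambda>\<omega>. \<lambda>l\<in>J. f (W l \<omega>)) \<in> measurable (uniform_measure M E) (Pi\<^sub>M J (\<lambda>_. borel))"
  proof (intro measurable_restrict)
    fix l assume "l \<in> J"
    then show "(\<lambda>\<omega>. f (W l \<omega>)) \<in> borel_measurable (uniform_measure M E)"
      using measurable_compose[OF W f] J by (auto cong: measurable_cong_sets)
  qed
  show ?thesis
  proof (rule prod.PiM_eqI)
    show "finite J" using I J finite_subset by auto
    show "sets (distr (uniform_measure M E) (Pi\<^sub>M J (\<lambda>_. borel)) (\<lambda>\<omega>. \<lambda>l\<in>J. f (W l \<omega>)))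
       = sets (Pi\<^sub>M J (\<lambda>_. ?\<mu>))" by (simp cong: sets_PiM_cong)
    fix C assume C: "\<And>l. l \<in> J \<Longrightarrow> C l \<in> sets ?\<mu>"
    \<comment> \<open>The pattern together with conditions on the values is again a rectangle.
      Coordinates outside \<open>J\<close> keep the factor they have in \<open>prob E\<close>, so
      they cancel in the quotient.\<close>
    let ?B = "\<lambda>l. if l \<in> J then V \<inter> (f -` C l \<inter> space N) else space N - V"
    let ?T = "(\<lambda>\<omega>. \<lambda>l\<in>J. f (W l \<omega>)) -` Pi\<^sub>E J C \<inter> space M"
    have Bs: "?B l \<in> sets N" for l using V C f by auto
    have rect: "E \<inter> ?T = {\<omega> \<in> space M. \<forall>l\<in>I. W l \<omega> \<in> ?B l}"
    proof (intro set_eqI)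
      fix \<omega>
      have "\<omega> \<in> ?T \<longleftrightarrow> \<omega> \<in> space M \<and> (\<forall>l\<in>J. f (W l \<omega>) \<in> C l)"
        by (auto simp: PiE_iff)
      moreover have "W l \<omega> \<in> space N" if "\<omega> \<in> space M" "l \<in> I" for l
        using measurable_space[OF W] that by auto
      ultimately show "\<omega> \<in> E \<inter> ?T \<longleftrightarrow> \<omega> \<in> {\<omega> \<in> space M. \<forall>l\<in>I. W l \<omega> \<in> ?B l}"
        using J unfolding E by (auto split: if_splits)
    qed
    have "prob (E \<inter> ?T) = (\<Prod>l\<in>I. measure \<nu> (?B l))"
      unfolding rect by (intro indep_vars_identical_rectangle[OF I ind law] Bs)
    moreover have Cm: "measure ?\<mu> (C l) = measure \<nu> (V \<inter> (f -` C l \<inter> space N)) / measure \<nu> V" if "l \<in> J" for l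
    proof -
      have "measure ?\<mu> (C l) = measure (uniform_measure \<nu> V) (f -` C l \<inter> space N)"
        using fu C[OF that] \<nu> by (subst measure_distr) auto
      also have "\<dots> = measure \<nu> (V \<inter> (f -` C l \<inter> space N)) / measure \<nu> V"
        using pos V \<nu> f C[OF that] by (intro measure_uniform_measure) (auto simp: \<nu>.emeasure_eq_measure)
      finally show ?thesis .
    qed
    ultimately have quot: "prob (E \<inter> ?T) / prob E = (\<Prod>l\<in>J. measure ?\<mu> (C l))"
    proof -
      have "prob (E \<inter> ?T) / prob E = (\<Prod>l\<in>I. measure \<nu> (?B l) / measure \<nu> (if l \<in> J then V else space N - V))"
        unfolding PE \<open>prob (E \<inter> ?T) = _\<close> by (simp add: prod_dividef)
      also have "\<dots> = (\<Prod>l\<in>I. if l \<in> J then measure ?\<mu> (C l) else 1)"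
      proof (intro prod.cong refl)
        fix l assume l: "l \<in> I"
        \<comment> \<open>No factor of the positive product \<open>prob E\<close> can
          vanish.\<close>
        have "measure \<nu> (if l \<in> J then V else space N - V) \<noteq> 0"
          using pos(1) l I unfolding PE by (metis less_irrefl prod_zero)
        then show "measure \<nu> (?B l) / measure \<nu> (if l \<in> J then V else space N - V)
          = (if l \<in> J then measure ?\<mu> (C l) else 1)" using Cm by (cases "l \<in> J") auto
      qed
      also have "\<dots> = (\<Prod>l\<in>J. measure ?\<mu> (C l))"
        using J I by (simp add: prod.If_cases Int_absorb1)
      finally show ?thesis .
    qed
    have CP: "Pi\<^sub>E J C \<in> sets (Pi\<^sub>M J (\<lambda>_. borel))"
      using C I J finite_subset by (intro sets_PiM_I_finite) auto
    interpret U: prob_space "uniform_measure M E"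
      using pos by (intro prob_space_uniform_measure) (auto simp: emeasure_eq_measure)
    have Ts: "?T \<in> sets M" using measurable_sets[OF meas CP] by simp
    have "emeasure (distr (uniform_measure M E) (Pi\<^sub>M J (\<lambda>_. borel)) (\<lambda>\<omega>. \<lambda>l\<in>J. f (W l \<omega>))) (Pi\<^sub>E J C)
       = emeasure (uniform_measure M E) ?T"
      using meas CP by (subst emeasure_distr) auto
    also have "\<dots> = ennreal (prob (E \<inter> ?T) / prob E)"
      unfolding U.emeasure_eq_measure using pos Es Ts
      by (subst measure_uniform_measure) (auto simp: emeasure_eq_measure)
    also have "\<dots> = (\<Prod>l\<in>J. emeasure ?\<mu> (C l))"
      unfolding quot \<mu>.emeasure_eq_measure by (simp add: prod_ennreal)
    finally show "emeasure (distr (uniform_measure M E) (Pi\<^sub>M J (\<lambda>_. borel)) (\<lambda>\<omega>. \<lambda>l\<in>J. f (W l \<omega>))) (Pi\<^sub>E J C)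
       = (\<Prod>l\<in>J. emeasure ?\<mu> (C l))" .
  qed
qed

end

section \<open>Uniform deviation of the empirical conditional distribution function\<close>

text \<open>The patterns \<open>E J\<close> partition the space: the empty one contributes the
  power, the others have conditional second moment at most \<open>2 / (card J + 1)\<close>, averaged
  over a binomial size. The majorant \<open>H\<close> works for all \<open>q\<close> at once, so a
  threshold depending on the sample may be inserted afterwards.\<close>

lemma (in prob_space) conditional_empirical_cdf_dominated:
  fixes f :: "'b \<Rightarrow> real" and W :: "nat \<Rightarrow> 'a \<Rightarrow> 'b"
  assumes I: "finite I" "I \<noteq> {}" and ind: "indep_vars (\<lambda>_. N) W I"
    and law: "\<And>l. l \<in> I \<Longrightarrow> distr M N (W l) = \<nu>"
    and f: "f \<in> borel_measurable N" and V: "V \<in> sets N" and pos: "0 < measure \<nu> V"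
  shows "\<exists>H \<in> borel_measurable M. (\<forall>\<omega>. 0 \<le> H \<omega>) \<and>
    (\<forall>\<omega>\<in>space M. \<forall>q.
      \<bar>(\<Sum>l\<in>I. (if f (W l \<omega>) \<le> q then 1 else 0) * (if W l \<omega> \<in> V then 1 else 0))
         / (\<Sum>l\<in>I. if W l \<omega> \<in> V then 1 else 0)
       - measure \<nu> {x \<in> V. f x \<le> q} / measure \<nu> V\<bar> \<le> H \<omega>) \<and>
    (\<integral>\<^sup>+\<omega>. ennreal (H \<omega>) \<partial>M)
      \<le> ennreal ((1 - measure \<nu> V) ^ card I + sqrt (pi / (real (card I) * measure \<nu> V)))"
proof -
  define n where "n = card I"
  define p where "p = measure \<nu> V"
  define c where "c = sqrt (pi / (real n * p))"
  define \<mu> where "\<mu> = distr (uniform_measure \<nu> V) borel f"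
  define E where "E J = {\<omega> \<in> space M. \<forall>l\<in>I. W l \<omega> \<in> V \<longleftrightarrow> l \<in> J}" for J
  define Z where "Z J \<omega> = (\<lambda>l\<in>J. f (W l \<omega>))" for J \<omega>
  have n: "0 < n" using I by (simp add: n_def card_gt_0_iff)
  have p: "0 < p" using pos by (simp add: p_def)
  have c: "0 < c" "c\<^sup>2 = pi / (real n * p)" using n p by (auto simp: c_def)
  have W: "W l \<in> measurable M N" if "l \<in> I" for l
    using ind that by (auto simp: indep_vars_def)
  obtain l0 where l0: "l0 \<in> I" using I by auto
  have \<nu>: "prob_space \<nu>" "sets \<nu> = sets N" "space \<nu> = space N"
    using prob_space_distr[OF W[OF l0]] law[OF l0] by auto
  interpret \<nu>: prob_space \<nu> by fact
  have p1: "p \<le> 1" by (simp add: p_def)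
  have fu: "f \<in> borel_measurable (uniform_measure \<nu> V)"
    using f \<nu> by (simp cong: measurable_cong_sets)
  have \<mu>: "prob_space \<mu>" "sets \<mu> = sets borel"
    unfolding \<mu>_def using pos V \<nu> fu by (auto intro!: prob_space.prob_space_distr prob_space_uniform_measure
      simp: \<nu>.emeasure_eq_measure)
  have \<mu>q: "measure \<mu> {..q} = measure \<nu> {x \<in> V. f x \<le> q} / p" for q
  proof -
    have "measure \<mu> {..q} = measure (uniform_measure \<nu> V) (f -` {..q} \<inter> space N)"
      unfolding \<mu>_def using fu \<nu> by (subst measure_distr) auto
    also have "\<dots> = measure \<nu> (V \<inter> (f -` {..q} \<inter> space N)) / p"
      unfolding p_def using pos V \<nu> measurable_sets[OF f, of "{..q}"]
      by (intro measure_uniform_measure) (auto simp: \<nu>.emeasure_eq_measure)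
    also have "V \<inter> (f -` {..q} \<inter> space N) = {x \<in> V. f x \<le> q}"
      using sets.sets_into_space[OF V] by auto
    finally show ?thesis .
  qed
  have E_eq: "E J = {\<omega> \<in> space M. \<forall>l\<in>I. W l \<omega> \<in> (if l \<in> J then V else space N - V)}" for J
    unfolding E_def by (rule pattern_event_eq[OF W])
  have Es: "E J \<in> events" for J
    unfolding E_def using I(1) W V by (rule pattern_event_in_events)
  have PE: "prob (E J) = p ^ card J * (1 - p) ^ (n - card J)" if "J \<subseteq> I" for J
  proof -
    have "prob (E J) = (\<Prod>l\<in>I. measure \<nu> (if l \<in> J then V else space N - V))"
      unfolding E_eq using V by (intro indep_vars_identical_rectangle[OF I ind law]) auto
    also have "\<dots> = (\<Prod>l\<in>I. if l \<in> J then p else 1 - p)"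
      using \<nu>.prob_compl[of V] V \<nu> by (intro prod.cong) (auto simp: p_def)
    also have "\<dots> = p ^ card (I \<inter> J) * (1 - p) ^ card (I - J)"
      using I by (simp add: prod.If_cases Diff_eq)
    finally show ?thesis using that I by (simp add: Int_absorb1 card_Diff_subset finite_subset n_def)
  qed
  define dominating where "dominating J G \<longleftrightarrow>
    G \<in> borel_measurable (Pi\<^sub>M J (\<lambda>_. \<mu>)) \<and> (\<forall>z. 0 \<le> G z) \<and>
    (\<forall>z \<in> space (Pi\<^sub>M J (\<lambda>_. \<mu>)). \<forall>q.
      (card {l \<in> J. z l \<le> q} / card J - measure \<mu> {..q})\<^sup>2 \<le> G z) \<and>
    (\<integral>\<^sup>+z. ennreal (G z) \<partial>Pi\<^sub>M J (\<lambda>_. \<mu>)) \<le> ennreal (2 / (real (card J) + 1))"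
    for J :: "nat set" and G
  have "\<exists>G. dominating J G" if "J \<subseteq> I" "J \<noteq> {}" for J
  proof -
    have "finite J" "0 < card J" using that I finite_subset by (auto simp: card_gt_0_iff)
    from empirical_cdf_square_dominated[OF \<mu> this(1) refl this(2)] show ?thesis
      unfolding dominating_def by blast
  qed
  then obtain G where "\<And>J. J \<subseteq> I \<Longrightarrow> J \<noteq> {} \<Longrightarrow> dominating J (G J)" by metis
  then have G: "\<And>J. J \<subseteq> I \<Longrightarrow> J \<noteq> {} \<Longrightarrow> G J \<in> borel_measurable (Pi\<^sub>M J (\<lambda>_. \<mu>))"
    "\<And>J z. J \<subseteq> I \<Longrightarrow> J \<noteq> {} \<Longrightarrow> 0 \<le> G J z"
    "\<And>J z q. J \<subseteq> I \<Longrightarrow> J \<noteq> {} \<Longrightarrow> z \<in> space (Pi\<^sub>M J (\<lambda>_. \<mu>)) \<Longrightarrow>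
       (card {l \<in> J. z l \<le> q} / card J - measure \<mu> {..q})\<^sup>2 \<le> G J z"
    "\<And>J. J \<subseteq> I \<Longrightarrow> J \<noteq> {} \<Longrightarrow>
      (\<integral>\<^sup>+z. ennreal (G J z) \<partial>Pi\<^sub>M J (\<lambda>_. \<mu>)) \<le> ennreal (2 / (real (card J) + 1))"
    unfolding dominating_def by blast+
  have sets_PiM: "sets (Pi\<^sub>M J (\<lambda>_. \<mu>)) = sets (Pi\<^sub>M J (\<lambda>_. borel))" for J :: "nat set"
    using \<mu> by (intro sets_PiM_cong) auto
  have Zm: "Z J \<in> measurable M (Pi\<^sub>M J (\<lambda>_. borel))" if "J \<subseteq> I" for J
    unfolding Z_def using measurable_compose[OF W f] that by (intro measurable_restrict) auto
  have Gm: "G J \<in> borel_measurable (Pi\<^sub>M J (\<lambda>_. borel))" if "J \<subseteq> I" "J \<noteq> {}" for J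
    using G(1)[OF that] measurable_cong_sets[OF sets_PiM refl] by blast
  have GZm: "(\<lambda>\<omega>. G J (Z J \<omega>)) \<in> borel_measurable M" if "J \<subseteq> I" "J \<noteq> {}" for J
    using measurable_compose[OF Zm Gm] that by auto
  have GE: "(\<integral>\<^sup>+\<omega>. ennreal (indicator (E J) \<omega> * G J (Z J \<omega>)) \<partial>M)
      \<le> ennreal (prob (E J) * (2 / (real (card J) + 1)))" if J: "J \<subseteq> I" "J \<noteq> {}" for J
  \<comment> \<open>Conditioning needs a pattern of positive probability; a null pattern contributes
    nothing.\<close>
  proof (cases "prob (E J) = 0")
    case True
    then have "AE \<omega> in M. \<omega> \<notin> E J" using Es[of J] by (simp add: prob_eq_0)
    then have "AE \<omega> in M. ennreal (indicator (E J) \<omega> * G J (Z J \<omega>)) = 0"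
      by eventually_elim auto
    then have "(\<integral>\<^sup>+\<omega>. ennreal (indicator (E J) \<omega> * G J (Z J \<omega>)) \<partial>M) = 0"
      by (simp add: nn_integral_cong_AE)
    then show ?thesis by simp
  next
    case False
    then have pos': "0 < prob (E J)" by (simp add: zero_less_measure_iff)
    have "(\<integral>\<^sup>+z. ennreal (G J z) \<partial>Pi\<^sub>M J (\<lambda>_. \<mu>))
       = (\<integral>\<^sup>+z. ennreal (G J z) \<partial>distr (uniform_measure M (E J)) (Pi\<^sub>M J (\<lambda>_. borel)) (Z J))"
      unfolding Z_def \<mu>_def
      by (subst distr_conditioned_on_pattern[OF I ind law f V J(1) E_def pos' pos]) auto
    also have "\<dots> = (\<integral>\<^sup>+\<omega>. ennreal (G J (Z J \<omega>)) \<partial>uniform_measure M (E J))"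
      using Zm[OF J(1)] Gm[OF J] by (intro nn_integral_distr) (auto cong: measurable_cong_sets)
    also have "\<dots> = (\<integral>\<^sup>+\<omega>. ennreal (G J (Z J \<omega>)) * indicator (E J) \<omega> \<partial>M) / emeasure M (E J)"
      using GZm[OF J] Es by (intro nn_integral_uniform_measure) auto
    also have "(\<integral>\<^sup>+\<omega>. ennreal (G J (Z J \<omega>)) * indicator (E J) \<omega> \<partial>M)
        = (\<integral>\<^sup>+\<omega>. ennreal (indicator (E J) \<omega> * G J (Z J \<omega>)) \<partial>M)"
      by (intro nn_integral_cong) (auto split: split_indicator)
    finally have "(\<integral>\<^sup>+\<omega>. ennreal (indicator (E J) \<omega> * G J (Z J \<omega>)) \<partial>M) / ennreal (prob (E J))
       \<le> ennreal (2 / (real (card J) + 1))"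
      using G(4)[OF J] by (simp add: emeasure_eq_measure)
    then have "(\<integral>\<^sup>+\<omega>. ennreal (indicator (E J) \<omega> * G J (Z J \<omega>)) \<partial>M)
        / ennreal (prob (E J)) * ennreal (prob (E J))
       \<le> ennreal (2 / (real (card J) + 1)) * ennreal (prob (E J))"
      by (intro mult_right_mono) auto
    moreover have "a / ennreal (prob (E J)) * ennreal (prob (E J)) = a" for a
      using pos' by (simp add: ennreal_divide_times ennreal_divide_self)
    moreover have "ennreal (2 / (real (card J) + 1)) * ennreal (prob (E J))
        = ennreal (prob (E J) * (2 / (real (card J) + 1)))"
      by (subst ennreal_mult[symmetric]) (auto simp: mult.commute)
    ultimately show ?thesis by (simp only:)
  qed
  define \<J> where "\<J> = Pow I - {{}}"
  have \<J>: "finite \<J>" "J \<in> \<J> \<Longrightarrow> J \<subseteq> I \<and> J \<noteq> {}" for J using I by (auto simp: \<J>_def)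
  \<comment> \<open>Since the patterns are disjoint, \<open>R\<close> selects the majorant of the
    subset actually observed, and is 0 if that subset is empty.\<close>
  define R where "R \<omega> = (\<Sum>J\<in>\<J>. indicator (E J) \<omega> * G J (Z J \<omega>))" for \<omega>
  have R0: "0 \<le> R \<omega>" for \<omega> unfolding R_def using \<J> G(2) by (intro sum_nonneg) auto
  have Rm [measurable]: "R \<in> borel_measurable M"
    unfolding R_def using \<J> GZm Es
    by (intro borel_measurable_sum borel_measurable_times borel_measurable_indicator) auto
  have RE: "(\<integral>\<^sup>+\<omega>. ennreal (R \<omega>) \<partial>M) \<le> ennreal (c\<^sup>2)"
  proof -
    have "(\<integral>\<^sup>+\<omega>. ennreal (R \<omega>) \<partial>M) = (\<integral>\<^sup>+\<omega>. (\<Sum>J\<in>\<J>. ennreal (indicator (E J) \<omega> * G J (Z J \<omega>))) \<partial>M)"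
      unfolding R_def using \<J> G(2) by (intro nn_integral_cong sum_ennreal[symmetric]) auto
    also have "\<dots> = (\<Sum>J\<in>\<J>. \<integral>\<^sup>+\<omega>. ennreal (indicator (E J) \<omega> * G J (Z J \<omega>)) \<partial>M)"
      using \<J> GZm Es
      by (intro nn_integral_sum measurable_compose[OF _ measurable_ennreal] borel_measurable_times
          borel_measurable_indicator) auto
    also have "\<dots> \<le> (\<Sum>J\<in>\<J>. ennreal (prob (E J) * (2 / (real (card J) + 1))))"
      using \<J> GE by (intro sum_mono) auto
    also have "\<dots> = ennreal (\<Sum>J\<in>\<J>. prob (E J) * (2 / (real (card J) + 1)))"
      by (intro sum_ennreal) auto
    also have "\<dots> \<le> ennreal (c\<^sup>2)"
    proof (rule ennreal_leI)
      \<comment> \<open>Adding the nonnegative term of the empty pattern completes the binomial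
        sum.\<close>
      have "(\<Sum>J\<in>\<J>. prob (E J) * (2 / (real (card J) + 1))) \<le> (\<Sum>J\<in>Pow I. prob (E J) * (2 / (real (card J) + 1)))"
        using I by (intro sum_mono2) (auto simp: \<J>_def)
      also have "\<dots> = (\<Sum>J\<in>Pow I. p ^ card J * (1 - p) ^ (n - card J) * (2 / (real (card J) + 1)))"
        using PE by (intro sum.cong) auto
      also have "\<dots> = (\<Sum>m\<le>n. (n choose m) * p ^ m * (1 - p) ^ (n - m) * (2 / (real m + 1)))"
        using sum_Pow_card[OF I(1), of "\<lambda>m. p ^ m * (1 - p) ^ (n - m) * (2 / (real m + 1))"]
        by (simp add: n_def mult.assoc)
      also have "\<dots> \<le> 2 / ((real n + 1) * p)" by (rule binomial_expectation_inverse_Suc_le[OF p p1])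
      also have "\<dots> \<le> pi / (real n * p)"
        using n p pi_ge_two by (intro frac_le mult_right_mono) auto
      finally show "(\<Sum>J\<in>\<J>. prob (E J) * (2 / (real (card J) + 1))) \<le> c\<^sup>2" unfolding c .
    qed
    finally show ?thesis .
  qed
  \<comment> \<open>AM-GM, \<open>sqrt R \<le> (R / c + c) / 2\<close>, replaces Jensen's inequality for the square root.\<close>
  define H where "H \<omega> = indicator (E {}) \<omega> + (R \<omega> / c + c) / 2" for \<omega>
  have Hm: "H \<in> borel_measurable M" unfolding H_def using Es[of "{}"] by measurable
  have H0: "0 \<le> H \<omega>" for \<omega> unfolding H_def using R0 c by simp
  have "(\<integral>\<^sup>+\<omega>. ennreal (H \<omega>) \<partial>M)
      = (\<integral>\<^sup>+\<omega>. indicator (E {}) \<omega> + (ennreal (1 / (2 * c)) * ennreal (R \<omega>) + ennreal (c / 2)) \<partial>M)"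
  proof (intro nn_integral_cong)
    fix \<omega>
    have "H \<omega> = indicator (E {}) \<omega> + (1 / (2 * c) * R \<omega> + c / 2)" using c by (simp add: H_def field_simps)
    then show "ennreal (H \<omega>) = indicator (E {}) \<omega> + (ennreal (1 / (2 * c)) * ennreal (R \<omega>) + ennreal (c / 2))"
      using R0[of \<omega>] c(1)
      by (simp add: ennreal_indicator ennreal_mult[symmetric] del: times_divide_eq_left)
  qed
  also have "\<dots> = emeasure M (E {}) + (ennreal (1 / (2 * c)) * (\<integral>\<^sup>+\<omega>. ennreal (R \<omega>) \<partial>M) + ennreal (c / 2))"
    using Es[of "{}"] by (subst nn_integral_add, simp, simp)+ (simp add: nn_integral_cmult emeasure_space_1)
  also have "\<dots> \<le> emeasure M (E {}) + (ennreal (1 / (2 * c)) * ennreal (c\<^sup>2) + ennreal (c / 2))"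
    using RE by (intro add_mono mult_left_mono) auto
  \<comment> \<open>The scale \<open>c\<close> in the AM-GM step is the square root of the bound on
    the mean of \<open>R\<close>, so \<open>c^2 / (2 * c)\<close> and \<open>c / 2\<close> add up to
    \<open>c\<close> without loss.\<close>
  also have "\<dots> = ennreal ((1 - p) ^ n + c)"
  proof -
    have "emeasure M (E {}) = ennreal ((1 - p) ^ n)" using PE[of "{}"] by (simp add: emeasure_eq_measure)
    moreover have "ennreal (1 / (2 * c)) * ennreal (c\<^sup>2) + ennreal (c / 2) = ennreal c"
      using c(1) by (simp add: power2_eq_square flip: ennreal_mult' ennreal_plus)
    ultimately show ?thesis using c(1) p1 by (simp add: ennreal_plus)
  qed
  finally have HE: "(\<integral>\<^sup>+\<omega>. ennreal (H \<omega>) \<partial>M) \<le> ennreal ((1 - p) ^ n + c)" .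
  have dom: "\<bar>(\<Sum>l\<in>I. (if f (W l \<omega>) \<le> q then 1 else 0) * (if W l \<omega> \<in> V then 1 else 0))
         / (\<Sum>l\<in>I. if W l \<omega> \<in> V then 1 else 0) - measure \<nu> {x \<in> V. f x \<le> q} / p\<bar> \<le> H \<omega>"
    if \<omega>: "\<omega> \<in> space M" for \<omega> q
  proof -
    define J where "J = {l \<in> I. W l \<omega> \<in> V}"
    have J: "J \<subseteq> I" "\<omega> \<in> E J" "finite J" using \<omega> I by (auto simp: J_def E_def)
    have den: "(\<Sum>l\<in>I. if W l \<omega> \<in> V then 1 else 0) = real (card J)"
      using I by (simp add: J_def sum.If_cases Int_def)
    have num: "(\<Sum>l\<in>I. (if f (W l \<omega>) \<le> q then 1 else 0) * (if W l \<omega> \<in> V then 1 else 0))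
        = real (card {l \<in> J. Z J \<omega> l \<le> q})"
    proof -
      have "(\<Sum>l\<in>I. (if f (W l \<omega>) \<le> q then 1 else 0) * (if W l \<omega> \<in> V then 1 else 0))
        = (\<Sum>l\<in>I. if l \<in> {l \<in> J. Z J \<omega> l \<le> q} then 1 else 0 :: real)"
        by (intro sum.cong) (auto simp: J_def Z_def)
      also have "\<dots> = real (card (I \<inter> {l \<in> J. Z J \<omega> l \<le> q}))" using I by (simp add: sum.If_cases)
      also have "I \<inter> {l \<in> J. Z J \<omega> l \<le> q} = {l \<in> J. Z J \<omega> l \<le> q}" using J by auto
      finally show ?thesis .
    qed
    have goal: "\<bar>card {l \<in> J. Z J \<omega> l \<le> q} / card J - measure \<mu> {..q}\<bar> \<le> H \<omega>"
    proof (cases "J = {}")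
      \<comment> \<open>Without a point in \<open>V\<close> the quotient is
        \<open>0 / 0 = 0\<close>, so the deviation is the distribution function itself, at most 1,
        and \<open>indicator (E {})\<close> covers it.\<close>
      case True
      have "measure \<mu> {..q} \<le> 1" using \<mu> by (simp add: prob_space.prob_le_1)
      then have "\<bar>card {l \<in> J. Z J \<omega> l \<le> q} / card J - measure \<mu> {..q}\<bar> \<le> 1"
        using True by simp
      also have "1 \<le> H \<omega>" using J True R0[of \<omega>] c by (simp add: H_def)
      finally show ?thesis .
    next
      case False
      let ?d = "\<bar>card {l \<in> J. Z J \<omega> l \<le> q} / card J - measure \<mu> {..q}\<bar>"
      have "Z J \<omega> \<in> space (Pi\<^sub>M J (\<lambda>_. \<mu>))"
        using measurable_space[OF Zm[OF J(1)] \<omega>] sets_eq_imp_space_eq[OF sets_PiM] by simp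
      then have "?d\<^sup>2 \<le> G J (Z J \<omega>)" using G(3)[OF J(1) False] by simp
      also have "\<dots> = indicator (E J) \<omega> * G J (Z J \<omega>)" using J by simp
      also have "\<dots> \<le> R \<omega>" unfolding R_def using J False \<J> G(2)
        by (intro member_le_sum) (auto simp: \<J>_def)
      finally have R: "?d\<^sup>2 \<le> R \<omega>" .
      have "2 * c * ?d \<le> ?d\<^sup>2 + c\<^sup>2" using sum_squares_bound[of ?d c]
        by (simp only: mult.assoc mult.commute[of c])
      then have "2 * c * ?d \<le> R \<omega> + c\<^sup>2" using R by simp
      then have "?d \<le> (R \<omega> + c\<^sup>2) / (2 * c)" using c(1) by (simp add: pos_le_divide_eq mult.commute)
      also have "\<dots> = (R \<omega> / c + c) / 2" using c(1) by (simp add: field_simps power2_eq_square)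
      also have "\<dots> \<le> H \<omega>" by (simp add: H_def)
      finally show ?thesis .
    qed
    then show ?thesis unfolding den num \<mu>q .
  qed
  show ?thesis
    using Hm H0 dom HE unfolding p_def n_def c_def by (intro bexI[of _ H]) auto
qed

section \<open>Recovering the clean distribution\<close>

lemma nn_integral_weighted_sum_le:
  fixes H :: "'i \<Rightarrow> 'a \<Rightarrow> real"
  assumes "\<And>x. x \<in> A \<Longrightarrow> H x \<in> borel_measurable M" "\<And>x \<omega>. x \<in> A \<Longrightarrow> 0 \<le> H x \<omega>"
    and "\<And>x. x \<in> A \<Longrightarrow> (\<integral>\<^sup>+\<omega>. ennreal (H x \<omega>) \<partial>M) \<le> ennreal (b x)"
    and "\<And>x. x \<in> A \<Longrightarrow> 0 \<le> c x" "\<And>x. x \<in> A \<Longrightarrow> 0 \<le> b x"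
  shows "(\<integral>\<^sup>+\<omega>. ennreal (\<Sum>x\<in>A. c x * H x \<omega>) \<partial>M) \<le> ennreal (\<Sum>x\<in>A. c x * b x)"
proof -
  have "(\<integral>\<^sup>+\<omega>. ennreal (\<Sum>x\<in>A. c x * H x \<omega>) \<partial>M)
      = (\<integral>\<^sup>+\<omega>. (\<Sum>x\<in>A. ennreal (c x) * ennreal (H x \<omega>)) \<partial>M)"
    using assms by (intro nn_integral_cong) (simp add: sum_ennreal[symmetric] ennreal_mult)
  also have "\<dots> = (\<Sum>x\<in>A. ennreal (c x) * (\<integral>\<^sup>+\<omega>. ennreal (H x \<omega>) \<partial>M))"
    using assms by (simp add: nn_integral_sum nn_integral_cmult)
  also have "\<dots> \<le> (\<Sum>x\<in>A. ennreal (c x) * ennreal (b x))"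
    using assms by (intro sum_mono mult_left_mono) auto
  also have "\<dots> = ennreal (\<Sum>x\<in>A. c x * b x)"
    using assms by (simp add: sum_ennreal[symmetric] ennreal_mult)
  finally show ?thesis .
qed

lemma (in prob_space) prob_split_by_label:
  fixes T :: "'a \<Rightarrow> nat"
  assumes "\<And>\<omega>. \<omega> \<in> space M \<Longrightarrow> T \<omega> \<in> {1..K}"
    and "\<And>i. i \<in> {1..K} \<Longrightarrow> {\<omega> \<in> space M. Q \<omega> \<and> T \<omega> = i} \<in> events"
  shows "prob {\<omega> \<in> space M. Q \<omega>} = (\<Sum>i=1..K. prob {\<omega> \<in> space M. Q \<omega> \<and> T \<omega> = i})"
proof -
  have "{\<omega> \<in> space M. Q \<omega>} = (\<Union>i\<in>{1..K}. {\<omega> \<in> space M. Q \<omega> \<and> T \<omega> = i})"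
    using assms(1) by auto
  also have "prob \<dots> = (\<Sum>i=1..K. prob {\<omega> \<in> space M. Q \<omega> \<and> T \<omega> = i})"
    using assms(2) by (intro finite_measure_finite_Union) (auto simp: disjoint_family_on_def)
  finally show ?thesis .
qed

text \<open>By conditional independence, the law of \<open>X\<close> given a noisy label is a
  mixture of its laws given the clean labels, with weights from \<open>trans_mat\<close>.
  Multiplying by the inverse matrix undoes the mixing.\<close>

lemma (in prob_space) clean_prob_from_noisy:
  assumes X: "X \<in> measurable M MX" and Y: "Y \<in> measurable M (count_space UNIV)"
    and Yt: "Yt \<in> measurable M (count_space UNIV)"
    and Y_range: "\<And>\<omega>. \<omega> \<in> space M \<Longrightarrow> Y \<omega> \<in> {1..K}"
    and ci: "cond_indep_given_label M MX X Y Yt"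
    and Pinv: "is_inverse_mat K (trans_mat M Y Yt) Pinv"
    and A: "A \<in> sets MX" and i: "i \<in> {1..K}"
  shows "(\<Sum>j=1..K. lab_prob M Y i * Pinv j i *
      (prob {\<omega> \<in> space M. X \<omega> \<in> A \<and> Yt \<omega> = j} / lab_prob M Yt j))
    = prob {\<omega> \<in> space M. X \<omega> \<in> A \<and> Y \<omega> = i}"
proof -
  note [measurable] = X Y Yt A
  define a where "a m = prob {\<omega> \<in> space M. X \<omega> \<in> A \<and> Y \<omega> = m}" for m
  have le: "a m \<le> lab_prob M Y m" for m
    unfolding a_def lab_prob_def by (intro finite_measure_mono) auto
  \<comment> \<open>A clean label of probability 0 has joint probability 0 with any event, so the
    convention for division by zero gives the right value.\<close>
  have a0: "a m = 0" if "lab_prob M Y m = 0" for m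
    using le[of m] that by (simp add: a_def measure_le_0_iff)
  have joint: "prob {\<omega> \<in> space M. (X \<omega> \<in> A \<and> Yt \<omega> = j) \<and> Y \<omega> = m} / lab_prob M Yt j
      = a m / lab_prob M Y m * trans_mat M Y Yt m j" for m j
  proof (cases "lab_prob M Y m = 0")
    case True
    have "prob {\<omega> \<in> space M. (X \<omega> \<in> A \<and> Yt \<omega> = j) \<and> Y \<omega> = m} \<le> lab_prob M Y m"
      unfolding lab_prob_def by (intro finite_measure_mono) auto
    then show ?thesis using True by (simp add: measure_le_0_iff)
  next
    case False
    have "prob {\<omega> \<in> space M. X \<omega> \<in> A \<and> Yt \<omega> = j \<and> Y \<omega> = m} * lab_prob M Y m
      = a m * prob {\<omega> \<in> space M. Yt \<omega> = j \<and> Y \<omega> = m}"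
      using ci A unfolding cond_indep_given_label_def a_def lab_prob_def by blast
    then have "prob {\<omega> \<in> space M. X \<omega> \<in> A \<and> Yt \<omega> = j \<and> Y \<omega> = m}
      = a m / lab_prob M Y m * prob {\<omega> \<in> space M. Yt \<omega> = j \<and> Y \<omega> = m}"
      using False by (simp add: field_simps)
    moreover have "{\<omega> \<in> space M. Y \<omega> = m \<and> Yt \<omega> = j} = {\<omega> \<in> space M. Yt \<omega> = j \<and> Y \<omega> = m}"
      by auto
    ultimately show ?thesis by (simp add: trans_mat_def conj_assoc)
  qed
  have "prob {\<omega> \<in> space M. X \<omega> \<in> A \<and> Yt \<omega> = j} / lab_prob M Yt j
      = (\<Sum>m=1..K. a m / lab_prob M Y m * trans_mat M Y Yt m j)" for j
  proof -
    have "prob {\<omega> \<in> space M. X \<omega> \<in> A \<and> Yt \<omega> = j}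
        = (\<Sum>m=1..K. prob {\<omega> \<in> space M. (X \<omega> \<in> A \<and> Yt \<omega> = j) \<and> Y \<omega> = m})"
      using Y_range by (intro prob_split_by_label) auto
    then show ?thesis by (simp only: sum_divide_distrib joint)
  qed
  then have "(\<Sum>j=1..K. lab_prob M Y i * Pinv j i *
      (prob {\<omega> \<in> space M. X \<omega> \<in> A \<and> Yt \<omega> = j} / lab_prob M Yt j))
    = (\<Sum>j=1..K. \<Sum>m=1..K. lab_prob M Y i * (a m / lab_prob M Y m) * (trans_mat M Y Yt m j * Pinv j i))"
    by (simp add: sum_distrib_left mult_ac)
  also have "\<dots> = (\<Sum>m=1..K. lab_prob M Y i * (a m / lab_prob M Y m) * (\<Sum>j=1..K. trans_mat M Y Yt m j * Pinv j i))"
    by (subst sum.swap) (simp add: sum_distrib_left)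
  \<comment> \<open>The right-inverse equation singles out the clean label
    \<open>m = i\<close>.\<close>
  also have "\<dots> = (\<Sum>m=1..K. lab_prob M Y i * (a m / lab_prob M Y m) * (if m = i then 1 else 0))"
    using Pinv i unfolding is_inverse_mat_def by (intro sum.cong) auto
  also have "\<dots> = lab_prob M Y i * (a i / lab_prob M Y i)"
    using i by (simp add: if_distrib[of "\<lambda>x. _ * x"] cong: if_cong)
  also have "\<dots> = a i" using a0[of i] by auto
  finally show ?thesis unfolding a_def .
qed

text \<open>Absorbing the single sum into the diagonal of the weights makes the estimator and
  \<open>g\<close> the same linear functional, applied to empirical and to true conditional
  distribution functions.\<close>

lemma sum_diagonal_correction:
  fixes w :: "nat \<Rightarrow> nat \<Rightarrow> real"
  shows "(\<Sum>i=1..K. \<Sum>j=1..K. (w i j - (if j = i then v i else 0)) * d i j)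
    = (\<Sum>i=1..K. \<Sum>j=1..K. w i j * d i j) - (\<Sum>i=1..K. v i * d i i)"
  by (simp add: left_diff_distrib sum_subtractf if_distrib[of "\<lambda>x. x * _"] cong: if_cong)

theorem theorem1:
  fixes M :: "'a measure" and MX :: "'x measure"
    and S :: "'x \<Rightarrow> nat \<Rightarrow> real"
    and K n k :: nat and eps :: real
    and X :: "'a \<Rightarrow> 'x" and Y Yt Yc :: "'a \<Rightarrow> nat" and Bflip :: "'a \<Rightarrow> bool"
    and Xc :: "nat \<Rightarrow> 'a \<Rightarrow> 'x" and Ytc :: "nat \<Rightarrow> 'a \<Rightarrow> nat"
    and Pinv :: "nat \<Rightarrow> nat \<Rightarrow> real"
  assumes M: "prob_space M"
    and K: "K \<ge> 2"
    and eps: "0 < eps" "eps < 1/2"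
    and S_meas: "\<forall>i\<in>{1..K}. (\<lambda>x. S x i) \<in> borel_measurable MX"
    and X_meas: "X \<in> measurable M MX"
    and Y_meas: "Y \<in> measurable M (count_space UNIV)"
    and Yt_meas: "Yt \<in> measurable M (count_space UNIV)"
    and Yc_meas: "Yc \<in> measurable M (count_space UNIV)"
    and B_meas: "Bflip \<in> measurable M (count_space UNIV)"
    and Y_range: "\<forall>\<omega>\<in>space M. Y \<omega> \<in> {1..K}"
    and Yc_range: "\<forall>\<omega>\<in>space M. Yc \<omega> \<in> {1..K}"
    and noise: "\<forall>\<omega>\<in>space M. Yt \<omega> = (if Bflip \<omega> then Yc \<omega> else Y \<omega>)"
    and B_prob: "measure M {\<omega> \<in> space M. Bflip \<omega>} = eps"
    and B_indep: "flip_indep M MX Bflip X Y Yc"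
    and cond_indep: "cond_indep_given_label M MX X Y Yt"
    and Pt_pos: "\<forall>i\<in>{1..K}. lab_prob M Yt i > 0"
    and Pinv: "is_inverse_mat K (trans_mat M Y Yt) Pinv"
    and k: "1 \<le> k" "k \<le> n"
    and Xc_meas: "\<forall>l\<in>{1..n}. Xc l \<in> measurable M MX"
    and Ytc_meas: "\<forall>l\<in>{1..n}. Ytc l \<in> measurable M (count_space UNIV)"
    and cal_indep: "prob_space.indep_vars M (\<lambda>_. MX \<Otimes>\<^sub>M count_space UNIV)
                      (\<lambda>l \<omega>. (Xc l \<omega>, Ytc l \<omega>)) {1..n}"
    and cal_dist: "\<forall>l\<in>{1..n}. distr M (MX \<Otimes>\<^sub>M count_space UNIV) (\<lambda>\<omega>. (Xc l \<omega>, Ytc l \<omega>))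
                              = distr M (MX \<Otimes>\<^sub>M count_space UNIV) (\<lambda>\<omega>. (X \<omega>, Yt \<omega>))"
  shows "let P = lab_prob M Y; Pt = lab_prob M Yt;
             g = (\<lambda>q. measure M {\<omega> \<in> space M. S (X \<omega>) (Y \<omega>) \<le> q}
                     - measure M {\<omega> \<in> space M. S (X \<omega>) (Yt \<omega>) \<le> q});
             Fn = (\<lambda>\<omega> q i j. emp_cond_cdf S n (\<lambda>l. Xc l \<omega>) (\<lambda>l. Ytc l \<omega>) q i j);
             ghat = (\<lambda>\<omega> q. (\<Sum>i=1..K. \<Sum>j=1..K. P i * Pinv j i * Fn \<omega> q i j)
                            - (\<Sum>i=1..K. Pt i * Fn \<omega> q i i));
             Sk = (\<lambda>\<omega>. order_stat S n (\<lambda>l. Xc l \<omega>) (\<lambda>l. Ytc l \<omega>) k)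
         in (\<integral>\<^sup>+\<omega>. ennreal \<bar>ghat \<omega> (Sk \<omega>) - g (Sk \<omega>)\<bar> \<partial>M)
            \<le> ennreal (\<Sum>i=1..K. \<bar>Pinv i i * P i - Pt i\<bar> * b_fun n (Pt i)
                  + (\<Sum>j\<in>{1..K} - {i}. \<bar>P i * Pinv j i\<bar> * b_fun n (Pt j)))"
proof -
  interpret prob_space M by fact
  define P where "P = lab_prob M Y"
  define Pt where "Pt = lab_prob M Yt"
  define g where "g q = prob {\<omega> \<in> space M. S (X \<omega>) (Y \<omega>) \<le> q}
    - prob {\<omega> \<in> space M. S (X \<omega>) (Yt \<omega>) \<le> q}" for q
  define Fn where "Fn \<omega> q i j = emp_cond_cdf S n (\<lambda>l. Xc l \<omega>) (\<lambda>l. Ytc l \<omega>) q i j" for \<omega> q i j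
  define F where "F q i j = prob {\<omega> \<in> space M. S (X \<omega>) i \<le> q \<and> Yt \<omega> = j} / Pt j" for q i j
  define Sk where "Sk \<omega> = order_stat S n (\<lambda>l. Xc l \<omega>) (\<lambda>l. Ytc l \<omega>) k" for \<omega>
  \<comment> \<open>On the diagonal this is the first weight of the bound, off the diagonal the
    second.\<close>
  define w where "w i j = P i * Pinv j i - (if j = i then Pt i else 0)" for i j
  let ?N = "MX \<Otimes>\<^sub>M count_space (UNIV :: nat set)"
  have n: "0 < n" using k by simp
  have Yt_range: "Yt \<omega> \<in> {1..K}" if "\<omega> \<in> space M" for \<omega>
    using that noise Y_range Yc_range by auto
  have A: "{x \<in> space MX. S x i \<le> q} \<in> sets MX" if "i \<in> {1..K}" for i q
    using S_meas that by (intro borel_measurable_le) auto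
  have inA: "{\<omega> \<in> space M. X \<omega> \<in> {x \<in> space MX. S x i \<le> q} \<and> T \<omega> = j}
      = {\<omega> \<in> space M. S (X \<omega>) i \<le> q \<and> T \<omega> = j}" for i j q and T :: "'a \<Rightarrow> nat"
    using measurable_space[OF X_meas] by auto
  have ev: "{\<omega> \<in> space M. S (X \<omega>) i \<le> q \<and> T \<omega> = j} \<in> events"
    if "i \<in> {1..K}" and T: "T \<in> measurable M (count_space UNIV)" for i q j and T :: "'a \<Rightarrow> nat"
  proof -
    have [measurable]: "(\<lambda>\<omega>. S (X \<omega>) i) \<in> borel_measurable M"
      using measurable_compose[OF X_meas S_meas[rule_format, OF that(1)]] .
    note T[measurable]
    show ?thesis by measurable
  qed
  have split: "prob {\<omega> \<in> space M. S (X \<omega>) (T \<omega>) \<le> q} = (\<Sum>i=1..K. prob {\<omega> \<in> space M. S (X \<omega>) i \<le> q \<and> T \<omega> = i})"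
    if T: "T \<in> measurable M (count_space UNIV)" and R: "\<And>\<omega>. \<omega> \<in> space M \<Longrightarrow> T \<omega> \<in> {1..K}"
    for T :: "'a \<Rightarrow> nat" and q
  proof -
    have eq: "{\<omega> \<in> space M. S (X \<omega>) (T \<omega>) \<le> q \<and> T \<omega> = i} = {\<omega> \<in> space M. S (X \<omega>) i \<le> q \<and> T \<omega> = i}" for i
      by auto
    show ?thesis
      using prob_split_by_label[of T K "\<lambda>\<omega>. S (X \<omega>) (T \<omega>) \<le> q"] R ev[OF _ T] by (simp add: eq)
  qed
  \<comment> \<open>An exact identity: \<open>g\<close> is the estimator with each \<open>Fn\<close>
    replaced by \<open>F\<close>, so all error comes from estimating conditional distribution
    functions.\<close>
  have g_eq: "g q = (\<Sum>i=1..K. \<Sum>j=1..K. P i * Pinv j i * F q i j) - (\<Sum>i=1..K. Pt i * F q i i)" for q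
  proof -
    have "(\<Sum>j=1..K. P i * Pinv j i * F q i j) = prob {\<omega> \<in> space M. S (X \<omega>) i \<le> q \<and> Y \<omega> = i}"
      if i: "i \<in> {1..K}" for i
      using clean_prob_from_noisy[OF X_meas Y_meas Yt_meas Y_range[rule_format] cond_indep Pinv A[OF i] i, of q]
      unfolding P_def F_def Pt_def inA .
    moreover have "Pt i * F q i i = prob {\<omega> \<in> space M. S (X \<omega>) i \<le> q \<and> Yt \<omega> = i}"
      if "i \<in> {1..K}" for i
      using Pt_pos[rule_format, OF that] by (simp add: F_def Pt_def)
    ultimately show ?thesis
      unfolding g_def using split[OF Y_meas] split[OF Yt_meas] Y_range Yt_range by simp
  qed
  \<comment> \<open>Bundling the properties of a majorant allows one choice of \<open>H\<close> for
    all pairs of labels.\<close>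
  define dominating where "dominating i j H \<longleftrightarrow> H \<in> borel_measurable M \<and> (\<forall>\<omega>. 0 \<le> H \<omega>) \<and>
    (\<forall>\<omega>\<in>space M. \<forall>q. \<bar>Fn \<omega> q i j - F q i j\<bar> \<le> H \<omega>) \<and>
    (\<integral>\<^sup>+\<omega>. ennreal (H \<omega>) \<partial>M) \<le> ennreal (b_fun n (Pt j))" for i j H
  have "\<exists>H. dominating i j H" if ij: "i \<in> {1..K}" "j \<in> {1..K}" for i j
  proof -
    \<comment> \<open>The relevant points are those with noisy label \<open>j\<close>, while the
      score is evaluated at the possibly different label \<open>i\<close>.\<close>
    let ?W = "\<lambda>l \<omega>. (Xc l \<omega>, Ytc l \<omega>)" and ?\<nu> = "distr M ?N (\<lambda>\<omega>. (X \<omega>, Yt \<omega>))"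
    let ?f = "\<lambda>z. S (fst z) i" and ?V = "{z \<in> space ?N. snd z = j}"
    have f [measurable]: "?f \<in> borel_measurable ?N"
      using ij by (intro measurable_compose[OF measurable_fst] S_meas[rule_format]) auto
    have V: "?V \<in> sets ?N" by measurable
    have XY: "(\<lambda>\<omega>. (X \<omega>, Yt \<omega>)) \<in> measurable M ?N" using X_meas Yt_meas by simp
    have Vq: "{z \<in> ?V. ?f z \<le> q} \<in> sets ?N" for q by measurable
    have \<nu>V: "measure ?\<nu> ?V = Pt j"
      unfolding Pt_def lab_prob_def measure_distr[OF XY V] using measurable_space[OF XY]
      by (intro arg_cong[where f = prob]) auto
    have \<nu>q: "measure ?\<nu> {z \<in> ?V. ?f z \<le> q} = prob {\<omega> \<in> space M. S (X \<omega>) i \<le> q \<and> Yt \<omega> = j}" for q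
      unfolding measure_distr[OF XY Vq] using measurable_space[OF XY]
      by (intro arg_cong[where f = prob]) auto
    have Wj: "?W l \<omega> \<in> ?V \<longleftrightarrow> Ytc l \<omega> = j" if "l \<in> {1..n}" "\<omega> \<in> space M" for l \<omega>
      using that Xc_meas measurable_space[of "Xc l" M MX] by (auto simp: space_pair_measure)
    have Fn_eq: "(\<Sum>l\<in>{1..n}. (if ?f (?W l \<omega>) \<le> q then 1 else 0) * (if ?W l \<omega> \<in> ?V then 1 else 0))
       / (\<Sum>l\<in>{1..n}. if ?W l \<omega> \<in> ?V then 1 else 0) = Fn \<omega> q i j" if "\<omega> \<in> space M" for \<omega> q
      unfolding Fn_def emp_cond_cdf_def using Wj[OF _ that]
      by (intro arg_cong2[where f = "(/)"] sum.cong) auto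
    have "0 < measure ?\<nu> ?V" using Pt_pos ij unfolding \<nu>V Pt_def by auto
    from conditional_empirical_cdf_dominated[OF _ _ cal_indep cal_dist[rule_format] f V this] n
    obtain H where H: "H \<in> borel_measurable M" "\<forall>\<omega>. 0 \<le> H \<omega>"
      "\<forall>\<omega>\<in>space M. \<forall>q. \<bar>(\<Sum>l\<in>{1..n}. (if ?f (?W l \<omega>) \<le> q then 1 else 0) * (if ?W l \<omega> \<in> ?V then 1 else 0))
       / (\<Sum>l\<in>{1..n}. if ?W l \<omega> \<in> ?V then 1 else 0)
        - measure ?\<nu> {z \<in> ?V. ?f z \<le> q} / measure ?\<nu> ?V\<bar> \<le> H \<omega>"
      "(\<integral>\<^sup>+\<omega>. ennreal (H \<omega>) \<partial>M)
        \<le> ennreal ((1 - measure ?\<nu> ?V) ^ card {1..n} + sqrt (pi / (real (card {1..n}) * measure ?\<nu> ?V)))"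
      by auto
    have "\<bar>Fn \<omega> q i j - F q i j\<bar> \<le> H \<omega>" if "\<omega> \<in> space M" for \<omega> q
      using H(3)[rule_format, OF that, of q] unfolding Fn_eq[OF that] \<nu>q \<nu>V F_def .
    then show ?thesis
      using H(1,2,4) unfolding \<nu>V dominating_def b_fun_def by (intro exI[of _ H]) auto
  qed
  then obtain H where "\<And>i j. i \<in> {1..K} \<Longrightarrow> j \<in> {1..K} \<Longrightarrow> dominating i j (H i j)" by metis
  then have H: "\<And>i j. i \<in> {1..K} \<Longrightarrow> j \<in> {1..K} \<Longrightarrow> H i j \<in> borel_measurable M"
    "\<And>i j \<omega>. i \<in> {1..K} \<Longrightarrow> j \<in> {1..K} \<Longrightarrow> 0 \<le> H i j \<omega>"
    "\<And>i j \<omega> q. i \<in> {1..K} \<Longrightarrow> j \<in> {1..K} \<Longrightarrow> \<omega> \<in> space M \<Longrightarrow> \<bar>Fn \<omega> q i j - F q i j\<bar> \<le> H i j \<omega>"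
    "\<And>i j. i \<in> {1..K} \<Longrightarrow> j \<in> {1..K} \<Longrightarrow> (\<integral>\<^sup>+\<omega>. ennreal (H i j \<omega>) \<partial>M) \<le> ennreal (b_fun n (Pt j))"
    unfolding dominating_def by blast+
  let ?ghat = "\<lambda>\<omega> q. (\<Sum>i=1..K. \<Sum>j=1..K. P i * Pinv j i * Fn \<omega> q i j) - (\<Sum>i=1..K. Pt i * Fn \<omega> q i i)"
  let ?KK = "{1..K} \<times> {1..K}"
  have pointwise: "\<bar>?ghat \<omega> q - g q\<bar> \<le> (\<Sum>(i, j)\<in>?KK. \<bar>w i j\<bar> * H i j \<omega>)" if "\<omega> \<in> space M" for \<omega> q
  proof -
    have "?ghat \<omega> q - g q = (\<Sum>(i, j)\<in>?KK. w i j * (Fn \<omega> q i j - F q i j))"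
    proof -
      have "(\<Sum>(i, j)\<in>?KK. w i j * (Fn \<omega> q i j - F q i j))
          = (\<Sum>i=1..K. \<Sum>j=1..K. w i j * Fn \<omega> q i j) - (\<Sum>i=1..K. \<Sum>j=1..K. w i j * F q i j)"
        by (simp add: sum.cartesian_product[symmetric] right_diff_distrib sum_subtractf)
      then show ?thesis
        unfolding w_def sum_diagonal_correction g_eq by (rule sym)
    qed
    also have "\<bar>\<dots>\<bar> \<le> (\<Sum>(i, j)\<in>?KK. \<bar>w i j * (Fn \<omega> q i j - F q i j)\<bar>)"
      by (rule order.trans[OF sum_abs]) (simp add: case_prod_beta')
    also have "\<dots> \<le> (\<Sum>(i, j)\<in>?KK. \<bar>w i j\<bar> * H i j \<omega>)"
      using H(3) that by (intro sum_mono) (auto simp: abs_mult intro!: mult_left_mono)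
    finally show ?thesis .
  qed
  have b0: "0 \<le> b_fun n (Pt j)" if "j \<in> {1..K}" for j
    unfolding b_fun_def Pt_def lab_prob_def by (intro add_nonneg_nonneg zero_le_power) auto
  \<comment> \<open>The pointwise bound holds for every \<open>q\<close>, so the order statistic can
    be inserted; monotonicity of the nonnegative integral asks for no measurability of the left
    integrand.\<close>
  have "(\<integral>\<^sup>+\<omega>. ennreal \<bar>?ghat \<omega> (Sk \<omega>) - g (Sk \<omega>)\<bar> \<partial>M)
      \<le> (\<integral>\<^sup>+\<omega>. ennreal (\<Sum>x\<in>?KK. \<bar>w (fst x) (snd x)\<bar> * H (fst x) (snd x) \<omega>) \<partial>M)"
    using pointwise by (intro nn_integral_mono ennreal_leI) (simp add: case_prod_beta')
  also have "\<dots> \<le> ennreal (\<Sum>x\<in>?KK. \<bar>w (fst x) (snd x)\<bar> * b_fun n (Pt (snd x)))"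
    using H b0 by (intro nn_integral_weighted_sum_le) auto
  also have "(\<Sum>x\<in>?KK. \<bar>w (fst x) (snd x)\<bar> * b_fun n (Pt (snd x)))
      = (\<Sum>i=1..K. \<Sum>j=1..K. \<bar>w i j\<bar> * b_fun n (Pt j))"
    by (simp add: sum.cartesian_product case_prod_beta')
  also have "\<dots> = (\<Sum>i=1..K. \<bar>Pinv i i * P i - Pt i\<bar> * b_fun n (Pt i)
      + (\<Sum>j\<in>{1..K} - {i}. \<bar>P i * Pinv j i\<bar> * b_fun n (Pt j)))"
  proof (intro sum.cong refl)
    fix i assume "i \<in> {1..K}"
    then have "(\<Sum>j=1..K. \<bar>w i j\<bar> * b_fun n (Pt j))
        = \<bar>w i i\<bar> * b_fun n (Pt i) + (\<Sum>j\<in>{1..K} - {i}. \<bar>w i j\<bar> * b_fun n (Pt j))"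
      by (intro sum.remove) auto
    also have "(\<Sum>j\<in>{1..K} - {i}. \<bar>w i j\<bar> * b_fun n (Pt j))
        = (\<Sum>j\<in>{1..K} - {i}. \<bar>P i * Pinv j i\<bar> * b_fun n (Pt j))"
      by (intro sum.cong) (auto simp: w_def)
    finally show "(\<Sum>j=1..K. \<bar>w i j\<bar> * b_fun n (Pt j)) = \<bar>Pinv i i * P i - Pt i\<bar> * b_fun n (Pt i)
      + (\<Sum>j\<in>{1..K} - {i}. \<bar>P i * Pinv j i\<bar> * b_fun n (Pt j))"
      by (simp add: w_def mult.commute)
  qed
  finally show ?thesis
    unfolding Let_def P_def Pt_def g_def Fn_def Sk_def .
qed

end
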